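(* Assume A1 and A3. Then for every $\theta=(\theta_i)_{i\ge 1}$ satisfying A2, the risk estimate $\widehat{\mathrm{ARE}}_n(\tau)$ of the predictors $\hat q(\tau)=(\hat q_1(\tau),\dots,\hat q_n(\tau))$, $\tau\in[0,\infty]$, satisfies $$\lim_{n\to\infty} a_n^8\,\Big\{\sup_{\tau\in[0,\infty]}\mathbb{E}\big(\widehat{\mathrm{ARE}}_n(\tau)-R_n(\theta,\hat q(\tau))\big)^2\Big\}=0,\qquad a_n=\log\log n,$$ where the expectation is over $X$.
   Context: Setting. $(\theta_i)_{i\ge1}$ are real numbers and $(\nu_{p,i}),(\nu_{f,i}),(b_i),(h_i)$ are known sequences of positive numbers. $N(\mu,\nu)$ is the normal law with mean $\mu$ and variance $\nu$; $\phi,\Phi$ are the standard normal density and CDF. For each $n$ (large enough that $\log\log n>0$), $X=(X_1,\dots,X_n)$ has independent coordinates $X_i\sim N(\theta_i,\nu_{p,i})$. Put $\tilde b_i=b_i/(b_i+h_i)$ and $G(w,\beta)=\phi(w)+w\Phi(w)-\beta w$. The loss of a prediction $q\in\mathbb{R}^n$ is $L_n(\theta,q)=\frac1n\sum_{i=1}^n l_i(\theta_i,q_i)$ with $l_i(\theta_i,q_i)=\sqrt{\nu_{f,i}}\,(b_i+h_i)\,G\big((q_i-\theta_i)/\sqrt{\nu_{f,i}},\tilde b_i\big)$, which equals $\mathbb{E}_{Y\sim N(\theta_i,\nu_{f,i})}[b_i(Y-q_i)^++h_i(q_i-Y)^+]$. The risk of a data-dependent predictor $\hat q=\hat q(X)$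 is $R_n(\theta,\hat q)=\mathbb{E}[L_n(\theta,\hat q(X))]$. Predictors. $\alpha_i(\tau)=\tau/(\tau+\nu_{p,i})$ for $\tau\in[0,\infty]$ ($\alpha_i(\infty)=1$), and $\hat q_i(\tau)=\alpha_i(\tau)X_i+\sqrt{\nu_{f,i}+\alpha_i(\tau)\nu_{p,i}}\;\Phi^{-1}(\tilde b_i)$. Assumptions. A1: $0<\inf_i\tilde b_i\le\sup_i\tilde b_i<1$ and $\sup_i(b_i+h_i)<\infty$. A2: $\limsup_{n\to\infty}\frac1n\sum_{i=1}^n|\theta_i|<\infty$. A3: $\sup_i\nu_{p,i}/\nu_{f,i}<1/(4e)$, $\sup_i\nu_{f,i}<\infty$, $\inf_i\nu_{p,i}>0$. Risk estimate. Let $$c_i(\tau)=\sqrt{\frac{\nu_{f,i}+\alpha_i(\tau)\nu_{p,i}}{\nu_{f,i}+\alpha_i(\tau)^2\nu_{p,i}}}\;\Phi^{-1}(\tilde b_i),\qquad d_i(\tau)=-\frac{1-\alpha_i(\tau)}{\sqrt{\nu_{f,i}+\alpha_i(\tau)^2\nu_{p,i}}},\qquad s_i(\tau)=\sqrt{2\nu_{p,i}}\,|d_i(\tau)|.$$ Fix for each $i$ any number $\gamma(i)$ with $0<\gamma(i)<1/\sqrt{4e}-\sqrt{\nu_{p,i}/\nu_{f,i}}$, and set $\lambda_n(i)=\gamma(i)\sqrt{2\log n}$ and $K_n(i)=1+\big\lceil e^2\big(\gamma(i)+\sqrt{2\nu_{p,i}/\nu_{f,i}}\big)^2(2\log n)\big\rceil$.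 With $H_k$ the probabilists' Hermite polynomials and $G'$ the derivative of $G$ in its first argument, put $$S_{i,\tau}(u)=G(0,\tilde b_i)+G'(0,\tilde b_i)\,u+\phi(0)\sum_{k=0}^{K_n(i)-2}\frac{(-1)^kH_k(0)}{(k+2)!}\,s_i(\tau)^{k+2}H_{k+2}\big(u/s_i(\tau)\big)$$ (when $s_i(\tau)=0$, $s^{m}H_m(u/s)$ is read as its limit $u^m$), and $\tilde S_{i,\tau}(u)=\mathrm{sign}(S_{i,\tau}(u))\min\{|S_{i,\tau}(u)|,n\}$. For $x,z\in\mathbb{R}$ let $U=c_i(\tau)+d_i(\tau)(x+\sqrt{\nu_{p,i}}z)$, $V=c_i(\tau)+d_i(\tau)(x-\sqrt{\nu_{p,i}}z)$, and define $\hat T_i(x,z,\tau)=-\tilde b_iU$ if $V<-\lambda_n(i)$; $=\tilde S_{i,\tau}(U)$ if $|V|\le\lambda_n(i)$; $=(1-\tilde b_i)U$ if $V>\lambda_n(i)$. Let $\hat T_i(x,\tau)=\mathbb{E}_{Z\sim N(0,1)}[\hat T_i(x,Z,\tau)]$ and $$\widehat{\mathrm{ARE}}_n(\tau)=\frac1n\sum_{i=1}^n(b_i+h_i)\sqrt{\nu_{f,i}+\nu_{p,i}\alpha_i(\tau)^2}\;\hat T_i(X_i,\tau).$$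
   Formalization: The numbers γ(i) are additionally required to be bounded away from zero, inf_i γ(i) > 0; with only the pointwise bounds the claim fails, e.g. for b=1, h=3, ν_p=1, ν_f=16, θ=0, γ(i)=0.01/i at τ=∞. *)

theory Defs
  imports "HOL-Probability.Probability"
begin

text \<open>
  Sequences are indexed by \<open>i \<ge> 1\<close>; values at index \<open>0\<close> are never used. Arguments \<open>\<nu>p\<close>, \<open>\<nu>f\<close> are
  variances, whereas the library's \<open>normal_density\<close> takes a standard deviation.
  Scalar functions below take the parameters of one coordinate, with \<open>\<beta> = b / (b + h)\<close>.
\<close>

definition Phi :: "real \<Rightarrow> real" where
  "Phi x = cdf std_normal_distribution x"

definition Phi_inv :: "real \<Rightarrow> real" where
  "Phi_inv p = (THE x. Phi x = p)"

definition crit_ratio :: "real \<Rightarrow> real \<Rightarrow> real" where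
  "crit_ratio b h = b / (b + h)"

definition G :: "real \<Rightarrow> real \<Rightarrow> real" where
  "G w \<beta> = std_normal_density w + w * Phi w - \<beta> * w"

definition loss_coord :: "real \<Rightarrow> real \<Rightarrow> real \<Rightarrow> real \<Rightarrow> real \<Rightarrow> real" where
  "loss_coord b h \<nu>f t q = sqrt \<nu>f * (b + h) * G ((q - t) / sqrt \<nu>f) (crit_ratio b h)"

definition loss ::
  "(nat \<Rightarrow> real) \<Rightarrow> (nat \<Rightarrow> real) \<Rightarrow> (nat \<Rightarrow> real) \<Rightarrow> nat \<Rightarrow> (nat \<Rightarrow> real) \<Rightarrow> (nat \<Rightarrow> real) \<Rightarrow> real" where
  "loss b h \<nu>f n \<theta> q = (\<Sum>i=1..n. loss_coord (b i) (h i) (\<nu>f i) (\<theta> i) (q i)) / real n"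

definition obs_law :: "(nat \<Rightarrow> real) \<Rightarrow> (nat \<Rightarrow> real) \<Rightarrow> nat \<Rightarrow> (nat \<Rightarrow> real) measure" where
  "obs_law \<theta> \<nu>p n = PiM {1..n} (\<lambda>i. density lborel (normal_density (\<theta> i) (sqrt (\<nu>p i))))"

definition risk ::
  "(nat \<Rightarrow> real) \<Rightarrow> (nat \<Rightarrow> real) \<Rightarrow> (nat \<Rightarrow> real) \<Rightarrow> (nat \<Rightarrow> real) \<Rightarrow> nat \<Rightarrow> (nat \<Rightarrow> real) \<Rightarrow>
    ((nat \<Rightarrow> real) \<Rightarrow> (nat \<Rightarrow> real)) \<Rightarrow> real" where
  "risk b h \<nu>p \<nu>f n \<theta> q = (\<integral>x. loss b h \<nu>f n \<theta> (q x) \<partial>obs_law \<theta> \<nu>p n)"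

text \<open>The hyperparameter \<open>\<tau>\<close> ranges over \<open>[0,\<infinity>]\<close>, that is, over the type \<^typ>\<open>ennreal\<close>.\<close>

definition alpha :: "real \<Rightarrow> ennreal \<Rightarrow> real" where
  "alpha \<nu>p \<tau> = (if \<tau> = \<infinity> then 1 else enn2real \<tau> / (enn2real \<tau> + \<nu>p))"

definition predictor ::
  "(nat \<Rightarrow> real) \<Rightarrow> (nat \<Rightarrow> real) \<Rightarrow> (nat \<Rightarrow> real) \<Rightarrow> (nat \<Rightarrow> real) \<Rightarrow> ennreal \<Rightarrow>
    (nat \<Rightarrow> real) \<Rightarrow> (nat \<Rightarrow> real)" where
  "predictor b h \<nu>p \<nu>f \<tau> x i =
     alpha (\<nu>p i) \<tau> * x i +
     sqrt (\<nu>f i + alpha (\<nu>p i) \<tau> * \<nu>p i) * Phi_inv (crit_ratio (b i) (h i))"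

definition c_coef :: "real \<Rightarrow> real \<Rightarrow> real \<Rightarrow> ennreal \<Rightarrow> real" where
  "c_coef \<beta> \<nu>p \<nu>f \<tau> =
     sqrt ((\<nu>f + alpha \<nu>p \<tau> * \<nu>p) / (\<nu>f + (alpha \<nu>p \<tau>)\<^sup>2 * \<nu>p)) * Phi_inv \<beta>"

definition d_coef :: "real \<Rightarrow> real \<Rightarrow> ennreal \<Rightarrow> real" where
  "d_coef \<nu>p \<nu>f \<tau> = - ((1 - alpha \<nu>p \<tau>) / sqrt (\<nu>f + (alpha \<nu>p \<tau>)\<^sup>2 * \<nu>p))"

definition s_coef :: "real \<Rightarrow> real \<Rightarrow> ennreal \<Rightarrow> real" where
  "s_coef \<nu>p \<nu>f \<tau> = sqrt (2 * \<nu>p) * \<bar>d_coef \<nu>p \<nu>f \<tau>\<bar>"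

definition lam :: "real \<Rightarrow> nat \<Rightarrow> real" where
  "lam \<gamma> n = \<gamma> * sqrt (2 * ln (real n))"

definition K_trunc :: "real \<Rightarrow> real \<Rightarrow> real \<Rightarrow> nat \<Rightarrow> nat" where
  "K_trunc \<gamma> \<nu>p \<nu>f n =
     1 + nat \<lceil>(exp 1)\<^sup>2 * (\<gamma> + sqrt (2 * \<nu>p / \<nu>f))\<^sup>2 * (2 * ln (real n))\<rceil>"

text \<open>Probabilists' Hermite polynomials.\<close>

fun hermite :: "nat \<Rightarrow> real \<Rightarrow> real" where
  "hermite 0 x = 1"
| "hermite (Suc 0) x = x"
| "hermite (Suc (Suc k)) x = x * hermite (Suc k) x - real (Suc k) * hermite k x"

text \<open>\<open>s\<^sup>m H\<^sub>m(u/s)\<close>, continuously extended to \<open>s = 0\<close>.\<close>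

definition hermite_scaled :: "nat \<Rightarrow> real \<Rightarrow> real \<Rightarrow> real" where
  "hermite_scaled m s u = (if s = 0 then u ^ m else s ^ m * hermite m (u / s))"

text \<open>
  The summation range \<open>0 \<le> k \<le> K - 2\<close> is written \<open>k < K - 1\<close>, which is empty for \<open>K = 1\<close>
  despite truncated subtraction.
\<close>

definition S_trunc :: "real \<Rightarrow> real \<Rightarrow> real \<Rightarrow> real \<Rightarrow> nat \<Rightarrow> ennreal \<Rightarrow> real \<Rightarrow> real" where
  "S_trunc \<beta> \<nu>p \<nu>f \<gamma> n \<tau> u =
     G 0 \<beta> + deriv (\<lambda>w. G w \<beta>) 0 * u +
     std_normal_density 0 *
       (\<Sum>k<K_trunc \<gamma> \<nu>p \<nu>f n - 1.
          (-1) ^ k * hermite k 0 / fact (k + 2) * hermite_scaled (k + 2) (s_coef \<nu>p \<nu>f \<tau>) u)"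

definition S_tilde :: "real \<Rightarrow> real \<Rightarrow> real \<Rightarrow> real \<Rightarrow> nat \<Rightarrow> ennreal \<Rightarrow> real \<Rightarrow> real" where
  "S_tilde \<beta> \<nu>p \<nu>f \<gamma> n \<tau> u =
     sgn (S_trunc \<beta> \<nu>p \<nu>f \<gamma> n \<tau> u) * min \<bar>S_trunc \<beta> \<nu>p \<nu>f \<gamma> n \<tau> u\<bar> (real n)"

definition T_rand :: "real \<Rightarrow> real \<Rightarrow> real \<Rightarrow> real \<Rightarrow> nat \<Rightarrow> real \<Rightarrow> real \<Rightarrow> ennreal \<Rightarrow> real" where
  "T_rand \<beta> \<nu>p \<nu>f \<gamma> n x z \<tau> =
     (let U = c_coef \<beta> \<nu>p \<nu>f \<tau> + d_coef \<nu>p \<nu>f \<tau> * (x + sqrt \<nu>p * z);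
          V = c_coef \<beta> \<nu>p \<nu>f \<tau> + d_coef \<nu>p \<nu>f \<tau> * (x - sqrt \<nu>p * z)
      in if V < - lam \<gamma> n then - \<beta> * U
         else if \<bar>V\<bar> \<le> lam \<gamma> n then S_tilde \<beta> \<nu>p \<nu>f \<gamma> n \<tau> U
         else (1 - \<beta>) * U)"

definition T_hat :: "real \<Rightarrow> real \<Rightarrow> real \<Rightarrow> real \<Rightarrow> nat \<Rightarrow> real \<Rightarrow> ennreal \<Rightarrow> real" where
  "T_hat \<beta> \<nu>p \<nu>f \<gamma> n x \<tau> = (\<integral>z. T_rand \<beta> \<nu>p \<nu>f \<gamma> n x z \<tau> \<partial>std_normal_distribution)"

definition ARE_hat ::
  "(nat \<Rightarrow> real) \<Rightarrow> (nat \<Rightarrow> real) \<Rightarrow> (nat \<Rightarrow> real) \<Rightarrow> (nat \<Rightarrow> real) \<Rightarrow> (nat \<Rightarrow> real) \<Rightarrow> nat \<Rightarrow>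
    ennreal \<Rightarrow> (nat \<Rightarrow> real) \<Rightarrow> real" where
  "ARE_hat b h \<nu>p \<nu>f \<gamma> n \<tau> x =
     (\<Sum>i=1..n. (b i + h i) * sqrt (\<nu>f i + \<nu>p i * (alpha (\<nu>p i) \<tau>)\<^sup>2) *
        T_hat (crit_ratio (b i) (h i)) (\<nu>p i) (\<nu>f i) (\<gamma> i) n (x i) \<tau>) / real n"

text \<open>
  On the choice of the constants \<open>\<gamma> i\<close>: the pointwise bounds
  \<open>0 < \<gamma> i < 1 / \<surd>(4e) - \<surd>(\<nu>p i / \<nu>f i)\<close> have to hold uniformly from below, \<open>0 < (INF i. \<gamma> i)\<close>.
  If \<open>\<gamma> i\<close> may vanish as \<open>i\<close> grows, the risk estimate need not be consistent: for \<open>\<gamma> i = \<epsilon> / i\<close>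
  (with \<open>\<epsilon>\<close> small) the thresholds \<open>lam (\<gamma> i) n\<close> are small for all but a vanishing fraction of the
  coordinates \<open>i \<le> n\<close>. At \<open>\<tau> = \<infinity>\<close>, \<open>U = V = Phi_inv \<beta>\<close> then falls outside the threshold if
  \<open>\<beta> \<noteq> 1/2\<close>, and \<open>T_hat\<close> is the constant \<open>max (- \<beta> * U) ((1 - \<beta>) * U)\<close>, which differs from its
  target \<open>G U \<beta>\<close>.
\<close>

end

theory Submission
  imports Defs "HOL-Computational_Algebra.Polynomial" "HOL-Real_Asymp.Real_Asymp"
begin

text \<open>
  Write \<open>\<omega> = c + d \<theta>\<close> and \<open>\<sigma> = d \<surd>(2 \<nu>p)\<close> for one coordinate. Its risk is, up to the factor
  \<open>(b + h) \<surd>(\<nu>f + \<alpha>\<^sup>2 \<nu>p)\<close>, equal to \<open>G \<omega> \<beta>\<close>; and a rotation by 45 degrees turns \<open>U\<close>, \<open>V\<close> into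
  independent variables \<open>\<omega> + \<sigma> A\<close>, \<open>\<omega> + \<sigma> B\<close> with \<open>A\<close>, \<open>B\<close> standard normal. The two linear branches
  of \<open>T_rand\<close> miss \<open>G \<omega> \<beta>\<close> by \<open>G (\<plusminus>\<omega>) 0\<close>, which is small unless \<open>V\<close> makes a large deviation. In the
  middle branch the Hermite series is unbiased for the Taylor polynomial of \<open>G\<close>, and its second
  moment is at most \<open>(K + 1)\<^sup>2 exp (\<omega>\<^sup>2 + K \<sigma>\<^sup>2)\<close>. If
  \<open>\<bar>\<omega>\<bar> \<le> (\<gamma> + \<surd>(2 \<nu>p / \<nu>f)) \<surd>(2 log n)\<close>, A3 and the condition on \<open>\<gamma>\<close> make this \<open>o(n)\<close>; otherwise
  the middle branch has probability \<open>O(1 / (n \<surd>log n))\<close>, and the truncation at \<open>n\<close> is enough.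
  Hence, uniformly in \<open>\<omega>\<close>, the bias is \<open>O(1 / \<surd>log n)\<close> and the mean square deviation from
  \<open>G \<omega> \<beta>\<close> is \<open>O(n / \<surd>log n)\<close>, so that the mean square error of the average is
  \<open>O(1 / \<surd>log n)\<close>.
\<close>

section \<open>Standard normal variables\<close>

text \<open>Everything is balanced at t = sqrt(2 log n). Let s = sqrt(2 \<nu>p / \<nu>f), which
  bounds |\<sigma>| for every \<tau>. If |\<omega>| > (\<gamma> + s) t, then |V| can stay within the
  threshold \<gamma> t only when |B| > t, an event of probability at most 2 / (n t). The n in the
  denominator cancels the truncation level, and the remaining 1 / t is the whole gain: without it
  the bias would merely be bounded. If |\<omega>| \<le> (\<gamma> + s) t, the condition on \<gamma>
  gives (\<gamma> + s)^2 \<le> 1/(2e), hence \<omega>^2 \<le> (log n)/e. The factor e^2 in K makes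
  the Taylor remainder a negative power of n, up to a logarithm, and costs K \<sigma>^2 \<le> (log
  n)/2 + O(1) in the second moment. The total exponent 1/e + 1/2 stays below 1; this is what the
  constant 4e secures. As \<omega> is arbitrary and s is free of \<tau>, the supremum over \<tau>
  comes at no extra cost.\<close>

abbreviation stdn :: "real measure" where
  "stdn \<equiv> std_normal_distribution"

lemma prob_space_stdn: "prob_space stdn"
  by (rule prob_space_normal_density) simp

interpretation stdn: prob_space stdn
  by (rule prob_space_stdn)

interpretation stdn2: pair_prob_space stdn stdn ..

lemma normal_eq_distr_stdn:
  assumes "0 < \<sigma>"
  shows "density lborel (normal_density \<mu> \<sigma>) = distr stdn borel (\<lambda>a. \<mu> + \<sigma> * a)"
proof -
  have "distributed stdn lborel (\<lambda>x. x) std_normal_density"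
    by (auto simp: distributed_def distr_id2)
  from stdn.normal_density_affine[OF this, of \<sigma> \<mu>] assms
  have "distributed stdn lborel (\<lambda>x. \<mu> + \<sigma> * x) (normal_density \<mu> \<sigma>)" by simp
  then show ?thesis
    by (auto simp: distributed_def cong: distr_cong)
qed

lemma distr_uminus_stdn: "distr stdn borel uminus = stdn"
proof -
  have "distributed stdn lborel (\<lambda>x. x) std_normal_density"
    by (auto simp: distributed_def distr_id2)
  from stdn.normal_density_affine[OF this, of "-1" 0]
  have "distributed stdn lborel uminus std_normal_density" by simp
  then show ?thesis
    by (auto simp: distributed_def cong: distr_cong)
qed

lemma distr_fst_stdn: "distr (stdn \<Otimes>\<^sub>M stdn) borel fst = stdn"
proof -
  have "distr (stdn \<Otimes>\<^sub>M stdn) stdn fst = stdn" by (rule stdn.distr_pair_fst)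
  then show ?thesis by (metis (no_types, lifting) distr_cong sets_density sets_lborel)
qed

lemma distr_snd_stdn: "distr (stdn \<Otimes>\<^sub>M stdn) borel snd = stdn"
proof -
  have "distr (stdn \<Otimes>\<^sub>M stdn) borel snd = distr (distr (stdn \<Otimes>\<^sub>M stdn) (stdn \<Otimes>\<^sub>M stdn) (\<lambda>(x, y). (y, x))) borel snd"
    using stdn2.distr_pair_swap by simp
  also have "\<dots> = distr (stdn \<Otimes>\<^sub>M stdn) borel fst"
    by (subst distr_distr) (auto simp: o_def case_prod_beta' intro!: distr_cong)
  finally show ?thesis using distr_fst_stdn by simp
qed

lemma indep_var_coordinates_stdn: "stdn2.indep_var borel fst borel snd"
  unfolding stdn2.indep_var_distribution_eq distr_fst_stdn distr_snd_stdn
proof (intro conjI)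
  have "stdn \<Otimes>\<^sub>M stdn = distr (stdn \<Otimes>\<^sub>M stdn) (borel \<Otimes>\<^sub>M borel) (\<lambda>x. x)"
    by (subst distr_id2) (auto intro!: sets_pair_measure_cong)
  then show "stdn \<Otimes>\<^sub>M stdn = distr (stdn \<Otimes>\<^sub>M stdn) (borel \<Otimes>\<^sub>M borel) (\<lambda>x. (fst x, snd x))"
    by simp
qed auto

text \<open>The first coefficient may vanish: in the risk computation it is proportional to
  \<alpha>, which is 0 at \<tau> = 0. The rule for sums of independent normals needs both deviations
  positive, hence the separate case.\<close>

lemma distr_linear_comb_stdn:
  assumes "q \<noteq> 0"
  shows "distr (stdn \<Otimes>\<^sub>M stdn) borel (\<lambda>(a, b). p * a + q * b) =
    distr stdn borel (\<lambda>a. sqrt (p\<^sup>2 + q\<^sup>2) * a)"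
proof -
  have s: "sqrt (p\<^sup>2 + q\<^sup>2) > 0" using assms by (simp add: add_nonneg_pos)
  have 1: "distributed (stdn \<Otimes>\<^sub>M stdn) lborel fst std_normal_density"
    using distr_fst_stdn by (auto simp: distributed_def cong: distr_cong)
  have 2: "distributed (stdn \<Otimes>\<^sub>M stdn) lborel snd std_normal_density"
    using distr_snd_stdn by (auto simp: distributed_def cong: distr_cong)
  have q: "distributed (stdn \<Otimes>\<^sub>M stdn) lborel (\<lambda>x. q * snd x) (normal_density 0 \<bar>q\<bar>)"
    using stdn2.normal_density_affine[OF 2, of q 0] assms by simp
  have "distributed (stdn \<Otimes>\<^sub>M stdn) lborel (\<lambda>x. p * fst x + q * snd x)
      (normal_density 0 (sqrt (p\<^sup>2 + q\<^sup>2)))"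
  proof (cases "p = 0")
    case True
    then show ?thesis using q by simp
  next
    case False
    have p: "distributed (stdn \<Otimes>\<^sub>M stdn) lborel (\<lambda>x. p * fst x) (normal_density 0 \<bar>p\<bar>)"
      using stdn2.normal_density_affine[OF 1, of p 0] False by simp
    have "stdn2.indep_var borel ((\<lambda>x. p * x) \<circ> fst) borel ((\<lambda>x. q * x) \<circ> snd)"
      by (rule stdn2.indep_var_compose[OF indep_var_coordinates_stdn]) auto
    then have "stdn2.indep_var borel (\<lambda>x. p * fst x) borel (\<lambda>x. q * snd x)"
      by (simp add: o_def)
    from stdn2.add_indep_normal[OF this _ _ p q] False assms show ?thesis by simp
  qed
  then have "distr (stdn \<Otimes>\<^sub>M stdn) borel (\<lambda>x. p * fst x + q * snd x) =
      density lborel (normal_density 0 (sqrt (p\<^sup>2 + q\<^sup>2)))"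
    by (auto simp: distributed_def cong: distr_cong)
  also have "\<dots> = distr stdn borel (\<lambda>a. sqrt (p\<^sup>2 + q\<^sup>2) * a)"
    using normal_eq_distr_stdn[OF s, of 0] by simp
  finally show ?thesis by (simp add: case_prod_beta')
qed

text \<open>
  The rotation by 45 degrees is a composition of two shears and a reflection, so
  one-dimensional affine substitutions suffice.
\<close>

lemma nn_integral_stdn_rotate:
  fixes f :: "real \<times> real \<Rightarrow> ennreal"
  assumes [measurable]: "f \<in> borel_measurable (borel \<Otimes>\<^sub>M borel)"
  shows "(\<integral>\<^sup>+z. \<integral>\<^sup>+x. f ((x + z) / sqrt 2, (x - z) / sqrt 2) \<partial>stdn \<partial>stdn) =
    (\<integral>\<^sup>+u. \<integral>\<^sup>+v. f (u, v) \<partial>stdn \<partial>stdn)"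
proof -
  let ?p = "\<lambda>x. ennreal (std_normal_density x)"
  \<comment> \<open>Rotation invariance: the product density depends on the radius only.\<close>
  have p: "std_normal_density x * std_normal_density z =
      std_normal_density u * std_normal_density v" if "x\<^sup>2 + z\<^sup>2 = u\<^sup>2 + v\<^sup>2" for x z u v
  proof -
    have "exp (- x\<^sup>2 / 2) * exp (- z\<^sup>2 / 2) = exp (- u\<^sup>2 / 2) * exp (- v\<^sup>2 / 2)"
      unfolding exp_add[symmetric] using that by (simp add: field_simps)
    then show ?thesis by (simp add: std_normal_density_def field_simps)
  qed
  have regroup: "e * (z * s * x * y) = u * (v * y)" if "z * x = u * v" "e * s = 1"
    for e s x y z u v :: ennreal
  proof -
    have "e * (z * s * x * y) = (e * s) * ((z * x) * y)" by (simp only: ac_simps)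
    then show ?thesis using that by (simp add: mult.assoc)
  qed
  have "(\<integral>\<^sup>+z. \<integral>\<^sup>+x. f ((x + z) / sqrt 2, (x - z) / sqrt 2) \<partial>stdn \<partial>stdn) =
     (\<integral>\<^sup>+z. ?p z * (\<integral>\<^sup>+x. ?p x * f ((x + z) / sqrt 2, (x - z) / sqrt 2) \<partial>lborel) \<partial>lborel)"
    by (simp add: nn_integral_density)
  \<comment> \<open>Substitutes x = sqrt 2 * u - z in the inner integral, so that the first argument
    of \<open>f\<close> becomes u.\<close>
  also have "\<dots> = (\<integral>\<^sup>+z. ?p z * (ennreal \<bar>sqrt 2\<bar> * (\<integral>\<^sup>+u. ?p (- z + sqrt 2 * u) *
       f ((- z + sqrt 2 * u + z) / sqrt 2, (- z + sqrt 2 * u - z) / sqrt 2) \<partial>lborel)) \<partial>lborel)"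
    by (intro nn_integral_cong arg_cong2[where f="(*)"] refl nn_integral_real_affine) auto
  also have "\<dots> = (\<integral>\<^sup>+z. (\<integral>\<^sup>+u. ?p z * ennreal (sqrt 2) * ?p (- z + sqrt 2 * u) *
       f (u, u - sqrt 2 * z) \<partial>lborel) \<partial>lborel)"
  proof (intro nn_integral_cong)
    fix z :: real
    have "(\<lambda>u. ?p (- z + sqrt 2 * u) *
       f ((- z + sqrt 2 * u + z) / sqrt 2, (- z + sqrt 2 * u - z) / sqrt 2)) =
       (\<lambda>u. ?p (- z + sqrt 2 * u) * f (u, u - sqrt 2 * z))"
    proof
      fix u :: real
      have "(- z + sqrt 2 * u + z) / sqrt 2 = u" "(- z + sqrt 2 * u - z) / sqrt 2 = u - sqrt 2 * z"
        by (simp_all add: field_simps)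
      then show "?p (- z + sqrt 2 * u) *
         f ((- z + sqrt 2 * u + z) / sqrt 2, (- z + sqrt 2 * u - z) / sqrt 2) =
         ?p (- z + sqrt 2 * u) * f (u, u - sqrt 2 * z)" by simp
    qed
    then show "?p z * (ennreal \<bar>sqrt 2\<bar> * (\<integral>\<^sup>+u. ?p (- z + sqrt 2 * u) *
       f ((- z + sqrt 2 * u + z) / sqrt 2, (- z + sqrt 2 * u - z) / sqrt 2) \<partial>lborel)) =
       (\<integral>\<^sup>+u. ?p z * ennreal (sqrt 2) * ?p (- z + sqrt 2 * u) * f (u, u - sqrt 2 * z) \<partial>lborel)"
      by (simp add: nn_integral_cmult[symmetric] mult.assoc)
  qed
  also have "\<dots> = (\<integral>\<^sup>+u. (\<integral>\<^sup>+z. ?p z * ennreal (sqrt 2) * ?p (- z + sqrt 2 * u) *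
       f (u, u - sqrt 2 * z) \<partial>lborel) \<partial>lborel)"
    by (rule lborel_pair.Fubini') measurable
  \<comment> \<open>Now z = (u - v) / sqrt 2. The Jacobians sqrt 2 and 1 / sqrt 2 of the two
    substitutions cancel.\<close>
  also have "\<dots> = (\<integral>\<^sup>+u. ennreal \<bar>- 1 / sqrt 2\<bar> * (\<integral>\<^sup>+v. ?p (u / sqrt 2 + (- 1 / sqrt 2) * v) * ennreal (sqrt 2) *
        ?p (- (u / sqrt 2 + (- 1 / sqrt 2) * v) + sqrt 2 * u) *
       f (u, u - sqrt 2 * (u / sqrt 2 + (- 1 / sqrt 2) * v)) \<partial>lborel) \<partial>lborel)"
    by (intro nn_integral_cong nn_integral_real_affine) auto
  also have "\<dots> = (\<integral>\<^sup>+u. (\<integral>\<^sup>+v. ?p u * (?p v * f (u, v)) \<partial>lborel) \<partial>lborel)"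
  proof (intro nn_integral_cong)
    fix u :: real
    have "ennreal \<bar>- 1 / sqrt 2\<bar> * (?p (u / sqrt 2 + (- 1 / sqrt 2) * v) * ennreal (sqrt 2) *
        ?p (- (u / sqrt 2 + (- 1 / sqrt 2) * v) + sqrt 2 * u) *
       f (u, u - sqrt 2 * (u / sqrt 2 + (- 1 / sqrt 2) * v))) = ?p u * (?p v * f (u, v))" for v
    proof -
      define z where "z = u / sqrt 2 + (- 1 / sqrt 2) * v"
      define x where "x = - z + sqrt 2 * u"
      have x: "x = (u + v) / sqrt 2" and z: "z = (u - v) / sqrt 2"
        by (simp_all add: x_def z_def field_simps)
      have *: "u - sqrt 2 * z = v" by (simp add: z)
      have "x\<^sup>2 + z\<^sup>2 = u\<^sup>2 + v\<^sup>2"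
        by (simp add: x z power_divide field_simps power2_eq_square)
      from p[OF this] have "?p z * ?p x = ?p u * ?p v"
        by (simp add: ennreal_mult[symmetric] mult.commute)
      moreover have "ennreal \<bar>- 1 / sqrt 2\<bar> * ennreal (sqrt 2) = 1"
        by (simp add: ennreal_mult[symmetric])
      ultimately show ?thesis
        unfolding z_def[symmetric] x_def[symmetric] * by (rule regroup)
    qed
    then show "ennreal \<bar>- 1 / sqrt 2\<bar> * (\<integral>\<^sup>+v. ?p (u / sqrt 2 + (- 1 / sqrt 2) * v) * ennreal (sqrt 2) *
        ?p (- (u / sqrt 2 + (- 1 / sqrt 2) * v) + sqrt 2 * u) *
       f (u, u - sqrt 2 * (u / sqrt 2 + (- 1 / sqrt 2) * v)) \<partial>lborel) =
       (\<integral>\<^sup>+v. ?p u * (?p v * f (u, v)) \<partial>lborel)"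
      by (subst nn_integral_cmult[symmetric]) auto
  qed
  also have "\<dots> = (\<integral>\<^sup>+u. \<integral>\<^sup>+v. f (u, v) \<partial>stdn \<partial>stdn)"
    by (simp add: nn_integral_density nn_integral_cmult)
  finally show ?thesis .
qed

lemma distr_stdn_rotate:
  "distr (stdn \<Otimes>\<^sub>M stdn) (stdn \<Otimes>\<^sub>M stdn) (\<lambda>(x, z). ((x + z) / sqrt 2, (x - z) / sqrt 2)) =
    stdn \<Otimes>\<^sub>M stdn"
proof (rule measure_eqI)
  let ?r = "\<lambda>(x::real, z::real). ((x + z) / sqrt 2, (x - z) / sqrt 2)"
  have [measurable]: "?r \<in> stdn \<Otimes>\<^sub>M stdn \<rightarrow>\<^sub>M stdn \<Otimes>\<^sub>M stdn" by measurable
  fix A assume "A \<in> sets (distr (stdn \<Otimes>\<^sub>M stdn) (stdn \<Otimes>\<^sub>M stdn) ?r)"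
  then have A: "A \<in> sets (stdn \<Otimes>\<^sub>M stdn)" by simp
  then have A': "A \<in> sets (borel \<Otimes>\<^sub>M borel)"
    by (simp cong: sets_pair_measure_cong)
  have "emeasure (distr (stdn \<Otimes>\<^sub>M stdn) (stdn \<Otimes>\<^sub>M stdn) ?r) A =
      (\<integral>\<^sup>+y. indicator A y \<partial>distr (stdn \<Otimes>\<^sub>M stdn) (stdn \<Otimes>\<^sub>M stdn) ?r)"
    using A by simp
  also have "\<dots> = (\<integral>\<^sup>+y. indicator A (?r y) \<partial>(stdn \<Otimes>\<^sub>M stdn))"
    using A by (subst nn_integral_distr) auto
  also have "\<dots> = (\<integral>\<^sup>+z. \<integral>\<^sup>+x. indicator A (?r (x, z)) \<partial>stdn \<partial>stdn)"
    using A by (subst stdn2.nn_integral_snd[symmetric]) auto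
  also have "\<dots> = (\<integral>\<^sup>+u. \<integral>\<^sup>+v. indicator A (u, v) \<partial>stdn \<partial>stdn)"
    using nn_integral_stdn_rotate[of "indicator A"] A' by simp
  also have "\<dots> = emeasure (stdn \<Otimes>\<^sub>M stdn) A"
    using A by (subst stdn.nn_integral_fst) auto
  finally show "emeasure (distr (stdn \<Otimes>\<^sub>M stdn) (stdn \<Otimes>\<^sub>M stdn) ?r) A = emeasure (stdn \<Otimes>\<^sub>M stdn) A" .
qed simp

section \<open>Hermite polynomials\<close>

lemma integrable_poly_stdn [simp, intro]:
  "integrable stdn (\<lambda>x. poly p (a + b * x))"
proof -
  have "integrable stdn (\<lambda>x. poly (pcompose p [:a, b:]) x)"
    unfolding poly_altdef
    by (intro Bochner_Integration.integrable_sum integrable_mult_right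
        integrable_std_normal_distribution_moment)
  then show ?thesis by (simp add: poly_pcompose mult.commute)
qed

section \<open>Gaussian integration by parts\<close>

lemma moment_stdn_Suc:
  "(\<integral>x. x * x ^ n \<partial>stdn) = real n * (\<integral>x. x ^ (n - 1) \<partial>stdn)"
proof (cases "even n")
  \<comment> \<open>For even n both sides are odd moments; at n = 0 the truncated exponent n - 1 is
    harmless because of the factor n.\<close>
  case True
  then have "odd (Suc n)" by simp
  then have 1: "(\<integral>x. x * x ^ n \<partial>stdn) = 0"
    using integral_std_normal_distribution_moment_odd[of "Suc n"] by simp
  show ?thesis
  proof (cases "n = 0")
    case False
    with True have "odd (n - 1)" by (cases n) auto
    then show ?thesis
      using 1 integral_std_normal_distribution_moment_odd[of "n - 1"] by simp
  qed (use 1 in simp)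
next
  case False
  then obtain k where n: "n = 2 * k + 1" by (elim oddE)
  have "(\<integral>x. x * x ^ n \<partial>stdn) = (\<integral>x. x ^ (2 * (k + 1)) \<partial>stdn)"
    by (simp add: n)
  also have "\<dots> = fact (2 * (k + 1)) / (2 ^ (k + 1) * fact (k + 1))"
    by (rule std_normal_distribution_even_moments)
  also have "\<dots> = real n * (fact (2 * k) / (2 ^ k * fact k))"
  proof -
    have "fact (2 * (k + 1)) = 2 * (real k + 1) * real n * fact (2 * k)"
      by (simp add: n algebra_simps)
    moreover have "2 ^ (k + 1) * fact (k + 1) = 2 * (real k + 1) * (2 ^ k * fact k)"
      by (simp add: algebra_simps)
    ultimately have "fact (2 * (k + 1)) / (2 ^ (k + 1) * fact (k + 1)) =
        (2 * (real k + 1)) * (real n * fact (2 * k)) / ((2 * (real k + 1)) * (2 ^ k * fact k))"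
      by (simp only: mult.assoc)
    also have "\<dots> = real n * fact (2 * k) / (2 ^ k * fact k)"
      by (rule mult_divide_mult_cancel_left) (simp add: add_eq_0_iff)
    finally show ?thesis by simp
  qed
  also have "fact (2 * k) / (2 ^ k * fact k) = (\<integral>x. x ^ (n - 1) \<partial>stdn)"
    using std_normal_distribution_even_moments(1)[of k] by (simp add: n)
  finally show ?thesis .
qed

text \<open>Stein's identity. Linearity reduces it to monomials, where it is the recursion for the
  moments.\<close>

lemma stein_stdn: "(\<integral>x. x * poly p x \<partial>stdn) = (\<integral>x. poly (pderiv p) x \<partial>stdn)"
proof -
  have I: "integrable stdn (\<lambda>x. poly q x)" "integrable stdn (\<lambda>x. x * poly q x)" for q
    using integrable_poly_stdn[of q 0 1] integrable_poly_stdn[of "[:0, 1:] * q" 0 1] by simp_all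
  have monom: "(\<integral>x. x * poly (monom c n) x \<partial>stdn) = (\<integral>x. poly (pderiv (monom c n)) x \<partial>stdn)"
    for c :: real and n
  proof -
    have "(\<integral>x. x * poly (monom c n) x \<partial>stdn) = (\<integral>x. c * (x * x ^ n) \<partial>stdn)"
      by (intro Bochner_Integration.integral_cong) (auto simp: poly_monom)
    also have "\<dots> = (\<integral>x. real n * c * x ^ (n - 1) \<partial>stdn)"
      by (simp add: moment_stdn_Suc)
    finally show ?thesis by (simp add: pderiv_monom poly_monom)
  qed
  have "(\<integral>x. x * poly (\<Sum>i\<in>A. monom (coeff p i) i) x \<partial>stdn) =
      (\<integral>x. poly (pderiv (\<Sum>i\<in>A. monom (coeff p i) i)) x \<partial>stdn)" if "finite A" for A
    using that
  proof (induction A rule: finite_induct)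
    case (insert n A)
    let ?m = "monom (coeff p n) n" and ?s = "\<Sum>i\<in>A. monom (coeff p i) i"
    have "(\<integral>x. x * poly (?m + ?s) x \<partial>stdn) = (\<integral>x. x * poly ?m x \<partial>stdn) + (\<integral>x. x * poly ?s x \<partial>stdn)"
      unfolding poly_add distrib_left by (intro Bochner_Integration.integral_add I)
    also have "\<dots> = (\<integral>x. poly (pderiv ?m) x \<partial>stdn) + (\<integral>x. poly (pderiv ?s) x \<partial>stdn)"
      by (simp only: monom insert.IH)
    also have "\<dots> = (\<integral>x. poly (pderiv (?m + ?s)) x \<partial>stdn)"
      unfolding pderiv_add poly_add by (intro Bochner_Integration.integral_add[symmetric] I)
    finally show ?case using insert.hyps by simp
  qed simp
  from this[of "{..degree p}"] show ?thesis
    by (simp only: poly_as_sum_of_monoms finite_atMost)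
qed

lemma stein_stdn_affine:
  "(\<integral>x. (a + b * x) * poly p (a + b * x) \<partial>stdn) =
    a * (\<integral>x. poly p (a + b * x) \<partial>stdn) + b\<^sup>2 * (\<integral>x. poly (pderiv p) (a + b * x) \<partial>stdn)"
proof -
  let ?q = "pcompose p [:a, b:]"
  have q: "poly ?q x = poly p (a + b * x)" for x by (simp add: poly_pcompose mult.commute)
  have q': "poly (pderiv ?q) x = b * poly (pderiv p) (a + b * x)" for x
    by (simp add: pderiv_pcompose poly_pcompose pderiv_pCons mult.commute)
  have "integrable stdn (\<lambda>x. x * poly ?q x)"
    using integrable_poly_stdn[of "[:0, 1:] * ?q" 0 1] by simp
  then have i: "integrable stdn (\<lambda>x. b * (x * poly p (a + b * x)))"
    unfolding q by simp
  have "(\<integral>x. (a + b * x) * poly p (a + b * x) \<partial>stdn) =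
      (\<integral>x. a * poly p (a + b * x) + b * (x * poly p (a + b * x)) \<partial>stdn)"
    by (simp add: algebra_simps)
  also have "\<dots> = (\<integral>x. a * poly p (a + b * x) \<partial>stdn) + (\<integral>x. b * (x * poly p (a + b * x)) \<partial>stdn)"
    by (intro Bochner_Integration.integral_add i) auto
  also have "\<dots> = a * (\<integral>x. poly p (a + b * x) \<partial>stdn) + b * (\<integral>x. x * poly ?q x \<partial>stdn)"
    by (simp add: q)
  also have "(\<integral>x. x * poly ?q x \<partial>stdn) = b * (\<integral>x. poly (pderiv p) (a + b * x) \<partial>stdn)"
    unfolding stein_stdn Bochner_Integration.integral_mult_right_zero[symmetric]
    by (intro Bochner_Integration.integral_cong refl q')
  finally show ?thesis by (simp add: power2_eq_square)
qed

text \<open>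
  Hermite polynomials with variance parameter \<open>v\<close>; for \<open>v = s\<^sup>2\<close> these are \<open>s\<^sup>m H\<^sub>m(u/s)\<close>,
  including the degenerate case \<open>v = 0\<close>.
\<close>

primrec hermite_poly :: "real \<Rightarrow> nat \<Rightarrow> real poly" where
  "hermite_poly v 0 = 1"
| "hermite_poly v (Suc m) = [:0, 1:] * hermite_poly v m - smult v (pderiv (hermite_poly v m))"

text \<open>Differentiating the recursion reproduces the same raising operator, applied to the
  derivative, plus one copy of the polynomial; so the factor grows by one in each step (Appell
  property).\<close>

lemma pderiv_hermite_poly:
  "pderiv (hermite_poly v m) = smult (real m) (hermite_poly v (m - 1))"
proof (induction m)
  case (Suc m)
  \<comment> \<open>For m = 0 both sides vanish; otherwise this is the defining recursion at m - 1,
    scaled by m.\<close>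
  have m: "smult (real m) (hermite_poly v m) = [:0, 1:] * smult (real m) (hermite_poly v (m - 1))
      - smult v (pderiv (smult (real m) (hermite_poly v (m - 1))))"
    by (cases m) (simp_all add: pderiv_smult smult_diff_right mult.commute)
  have "pderiv (hermite_poly v (Suc m)) = hermite_poly v m +
      ([:0, 1:] * pderiv (hermite_poly v m) - smult v (pderiv (pderiv (hermite_poly v m))))"
    by (simp add: pderiv_diff pderiv_mult pderiv_smult pderiv_pCons)
  also have "\<dots> = hermite_poly v m + smult (real m) (hermite_poly v m)"
    unfolding Suc.IH m ..
  also have "\<dots> = smult (real (Suc m)) (hermite_poly v m)"
    by (simp add: smult_add_left)
  finally show ?case by simp
qed simp

lemma hermite_poly_rec:
  "hermite_poly v (Suc (Suc m)) =
    [:0, 1:] * hermite_poly v (Suc m) - smult (v * real (Suc m)) (hermite_poly v m)"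
  by (simp only: hermite_poly.simps(2)[of v "Suc m"] pderiv_hermite_poly diff_Suc_1 smult_smult)

lemma hermite_scaled_eq_poly: "hermite_scaled m s u = poly (hermite_poly (s\<^sup>2) m) u"
proof (induction m rule: induct_nat_012)
  case 0
  then show ?case by (simp add: hermite_scaled_def)
next
  case 1
  then show ?case by (simp add: hermite_scaled_def)
next
  case (ge2 m)
  have "hermite_scaled (Suc (Suc m)) s u =
      u * hermite_scaled (Suc m) s u - s\<^sup>2 * real (Suc m) * hermite_scaled m s u"
    by (auto simp: hermite_scaled_def field_simps power2_eq_square)
  also have "\<dots> = poly (hermite_poly (s\<^sup>2) (Suc (Suc m))) u"
    unfolding hermite_poly_rec ge2 by simp
  finally show ?case .
qed

text \<open>Under the normal law with mean a and variance v = b^2, Stein's identity makes the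
  raising operator u - v d/du the adjoint of a + v d/du.\<close>

lemma integral_hermite_poly_Suc_mult:
  fixes a b :: real and f :: "real poly"
  shows "(\<integral>x. poly (hermite_poly (b\<^sup>2) (Suc m) * f) (a + b * x) \<partial>stdn) =
    a * (\<integral>x. poly (hermite_poly (b\<^sup>2) m * f) (a + b * x) \<partial>stdn) +
    b\<^sup>2 * (\<integral>x. poly (hermite_poly (b\<^sup>2) m * pderiv f) (a + b * x) \<partial>stdn)"
proof -
  let ?h = "hermite_poly (b\<^sup>2) m"
  let ?E = "\<lambda>p. \<integral>x. poly p (a + b * x) \<partial>stdn"
  have "?E (hermite_poly (b\<^sup>2) (Suc m) * f) =
      (\<integral>x. (a + b * x) * poly (?h * f) (a + b * x) - b\<^sup>2 * poly (pderiv ?h * f) (a + b * x) \<partial>stdn)"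
    by (intro Bochner_Integration.integral_cong) (auto simp: algebra_simps)
  also have "\<dots> = (\<integral>x. (a + b * x) * poly (?h * f) (a + b * x) \<partial>stdn) -
      (\<integral>x. b\<^sup>2 * poly (pderiv ?h * f) (a + b * x) \<partial>stdn)"
  proof (intro Bochner_Integration.integral_diff)
    show "integrable stdn (\<lambda>x. (a + b * x) * poly (?h * f) (a + b * x))"
      using integrable_poly_stdn[of "[:0, 1:] * (?h * f)" a b] by simp
    show "integrable stdn (\<lambda>x. b\<^sup>2 * poly (pderiv ?h * f) (a + b * x))"
      by (intro integrable_mult_right integrable_poly_stdn)
  qed
  also have "\<dots> = a * ?E (?h * f) + b\<^sup>2 * ?E (pderiv (?h * f)) - b\<^sup>2 * ?E (pderiv ?h * f)"
    unfolding stein_stdn_affine by simp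
  also have "?E (pderiv (?h * f)) = ?E (?h * pderiv f) + ?E (pderiv ?h * f)"
    unfolding pderiv_mult poly_add
    by (subst Bochner_Integration.integral_add) (simp_all only: integrable_poly_stdn mult.commute[of f])
  finally show ?thesis by (simp add: algebra_simps)
qed

lemma integral_hermite_poly: "(\<integral>x. poly (hermite_poly (b\<^sup>2) m) (a + b * x) \<partial>stdn) = a ^ m"
proof (induction m)
  case (Suc m)
  then show ?case using integral_hermite_poly_Suc_mult[of b m 1 a] by simp
qed (use stdn.prob_space in simp)

text \<open>Moving one raising operator to the other factor expresses the moment (m+1, l+1) through
  (m, l+1) and (m, l), the latter with the factor b^2 (l+1). The common bound N on the indices keeps
  the growth factor a^2 + N b^2 fixed during the induction.\<close>

lemma abs_integral_hermite_poly_mult_le: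
  assumes "m \<le> k" "k \<le> N"
  shows "\<bar>\<integral>x. poly (hermite_poly (b\<^sup>2) m * hermite_poly (b\<^sup>2) k) (a + b * x) \<partial>stdn\<bar> \<le>
    \<bar>a\<bar> ^ (k - m) * (a\<^sup>2 + real N * b\<^sup>2) ^ m"
  using assms
proof (induction m arbitrary: k)
  case 0
  then show ?case using integral_hermite_poly[of b k a] by (simp add: power_abs)
next
  case (Suc m)
  then obtain l where k: "k = Suc l" and l: "m \<le> l" "l \<le> N" by (cases k) auto
  define M where "M = (\<lambda>m k. \<integral>x. poly (hermite_poly (b\<^sup>2) m * hermite_poly (b\<^sup>2) k) (a + b * x) \<partial>stdn)"
  define R where "R = (a\<^sup>2 + real N * b\<^sup>2) ^ m"
  have R: "R \<ge> 0" by (simp add: R_def)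
  have "M (Suc m) (Suc l) = a * M m (Suc l) + b\<^sup>2 * (real (Suc l) * M m l)"
  proof -
    have "M (Suc m) (Suc l) = a * M m (Suc l) +
        b\<^sup>2 * (\<integral>x. poly (hermite_poly (b\<^sup>2) m * pderiv (hermite_poly (b\<^sup>2) (Suc l))) (a + b * x) \<partial>stdn)"
      unfolding M_def by (rule integral_hermite_poly_Suc_mult)
    then show ?thesis
      by (simp only: M_def pderiv_hermite_poly mult_smult_right poly_smult diff_Suc_1
          Bochner_Integration.integral_mult_right_zero)
  qed
  then have "\<bar>M (Suc m) (Suc l)\<bar> \<le> \<bar>a * M m (Suc l)\<bar> + \<bar>b\<^sup>2 * (real (Suc l) * M m l)\<bar>"
    by (simp only: abs_triangle_ineq)
  also have "\<dots> = \<bar>a\<bar> * \<bar>M m (Suc l)\<bar> + b\<^sup>2 * (real (Suc l) * \<bar>M m l\<bar>)"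
    by (simp add: abs_mult)
  also have "\<dots> \<le> \<bar>a\<bar> * (\<bar>a\<bar> ^ (Suc l - m) * R) + b\<^sup>2 * (real N * (\<bar>a\<bar> ^ (l - m) * R))"
  proof (intro add_mono mult_left_mono)
    show "\<bar>M m (Suc l)\<bar> \<le> \<bar>a\<bar> ^ (Suc l - m) * R"
      unfolding M_def R_def using l Suc.prems k by (intro Suc.IH) auto
    have "\<bar>M m l\<bar> \<le> \<bar>a\<bar> ^ (l - m) * R"
      unfolding M_def R_def using l by (intro Suc.IH) auto
    then show "real (Suc l) * \<bar>M m l\<bar> \<le> real N * (\<bar>a\<bar> ^ (l - m) * R)"
      using Suc.prems k by (intro mult_mono) auto
  qed auto
  also have "\<dots> = \<bar>a\<bar> ^ (l - m) * ((\<bar>a\<bar>\<^sup>2 + real N * b\<^sup>2) * R)"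
  proof -
    have "A * (A ^ Suc p * R) + b\<^sup>2 * (real N * (A ^ p * R)) = A ^ p * ((A\<^sup>2 + real N * b\<^sup>2) * R)"
      for A :: real and p
      by (simp only: power_Suc power2_eq_square distrib_left distrib_right ac_simps)
    then show ?thesis using l by (simp only: Suc_diff_le)
  qed
  finally show ?case
    by (simp only: M_def k R_def power2_abs diff_Suc_Suc power_Suc)
qed

lemma integral_hermite_poly_sq_le:
  "(\<integral>x. (poly (hermite_poly (b\<^sup>2) m) (a + b * x))\<^sup>2 \<partial>stdn) \<le> (a\<^sup>2 + real m * b\<^sup>2) ^ m"
proof -
  have "\<bar>\<integral>x. (poly (hermite_poly (b\<^sup>2) m) (a + b * x))\<^sup>2 \<partial>stdn\<bar> \<le>
      \<bar>a\<bar> ^ (m - m) * (a\<^sup>2 + real m * b\<^sup>2) ^ m"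
    using abs_integral_hermite_poly_mult_le[OF order_refl order_refl]
    unfolding poly_mult power2_eq_square[symmetric] poly_power .
  then show ?thesis by simp
qed

text \<open>At 0 the recursion multiplies by -(k+1) over two steps, so the square gains (k+1)^2
  only. This keeps the squared coefficient of degree k in the series below 1/k!.\<close>

lemma hermite_0_sq_le: "(hermite k 0)\<^sup>2 \<le> fact k"
proof (induction k rule: induct_nat_012)
  case (ge2 k)
  have "(hermite (Suc (Suc k)) 0)\<^sup>2 = (real (Suc k))\<^sup>2 * (hermite k 0)\<^sup>2"
    by (simp only: hermite.simps mult_zero_left diff_0 power2_minus power_mult_distrib)
  also have "\<dots> \<le> (real (Suc (Suc k)) * real (Suc k)) * fact k"
    unfolding power2_eq_square[of "real (Suc k)"]
    by (rule mult_mono[OF mult_right_mono ge2(1)]) simp_all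
  also have "\<dots> = fact (Suc (Suc k))" by (simp only: fact_Suc of_nat_mult mult.assoc of_nat_fact)
  finally show ?case .
qed simp_all

text \<open>One term of a series with nonnegative terms. It serves the second moments as well as J^J
  / J! in the Taylor remainder.\<close>

lemma power_le_fact_mult_exp:
  fixes x :: real
  assumes "0 \<le> x"
  shows "x ^ n \<le> fact n * exp x"
proof -
  have "(\<Sum>i\<in>{n}. x ^ i /\<^sub>R fact i) \<le> (\<Sum>i. x ^ i /\<^sub>R fact i)"
    using assms by (intro sum_le_suminf[OF summable_exp_generic]) auto
  then have "x ^ n /\<^sub>R fact n \<le> exp x" by (simp add: exp_def)
  then show ?thesis by (simp add: field_simps)
qed

section \<open>The function G and its series\<close>

lemma integral_stdn: "(\<integral>x. f x \<partial>stdn) = (\<integral>x. std_normal_density x * f x \<partial>lborel)"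
  if "f \<in> borel_measurable borel" for f :: "real \<Rightarrow> real"
  using that by (subst integral_density) auto

lemma std_normal_density_le_exp: "std_normal_density x \<le> exp (- x\<^sup>2 / 2)"
proof -
  have "1 / sqrt (2 * pi) \<le> 1" using pi_ge_two by (simp add: real_le_rsqrt)
  then have "1 / sqrt (2 * pi) * exp (- x\<^sup>2 / 2) \<le> 1 * exp (- x\<^sup>2 / 2)"
    by (intro mult_right_mono) auto
  then show ?thesis by (simp add: std_normal_density_def)
qed

lemma std_normal_density_le_1: "std_normal_density x \<le> 1"
  using order.trans[OF std_normal_density_le_exp[of x], of 1] by simp

lemma DERIV_std_normal_density [derivative_intros]:
  assumes "(f has_real_derivative f') (at x within A)"
  shows "((\<lambda>x. std_normal_density (f x)) has_real_derivative - f x * std_normal_density (f x) * f') (at x within A)"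
  unfolding std_normal_density_def
  using assms by (auto intro!: derivative_eq_intros simp: field_simps)

lemma Phi_eq_add_integral:
  assumes "a \<le> x"
  shows "Phi x = Phi a + integral {a..x} std_normal_density"
proof -
  have cont: "continuous_on {a..x} std_normal_density"
    unfolding std_normal_density_def by (intro continuous_intros) auto
  interpret real_distribution stdn by (rule real_dist_normal_dist)
  have "Phi x - Phi a = measure stdn {a<..x}"
    unfolding Phi_def using assms by (cases "a = x") (auto intro!: cdf_diff_eq)
  \<comment> \<open>The law has no atom at a, so the half-open interval of the distribution function
    may be closed.\<close>
  also have "\<dots> = measure stdn {a..x}"
  proof (intro measure_eq_AE)
    have "AE y in lborel. y \<noteq> a" by (rule AE_lborel_singleton)
    then have "AE y in stdn. y \<noteq> a" by (auto simp: AE_density)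
    then show "AE y in stdn. y \<in> {a<..x} \<longleftrightarrow> y \<in> {a..x}" by eventually_elim auto
  qed auto
  also have "\<dots> = (\<integral>y. indicator {a..x} y \<partial>stdn)" by simp
  also have "\<dots> = (LINT y:{a..x}|lborel. std_normal_density y)"
    unfolding set_lebesgue_integral_def by (subst integral_stdn) (auto simp: mult.commute)
  also have "\<dots> = integral {a..x} std_normal_density"
    using borel_integrable_atLeastAtMost'[OF cont] by (rule set_borel_integral_eq_integral)
  finally show ?thesis by simp
qed

lemma DERIV_Phi: "(Phi has_real_derivative std_normal_density x) (at x)"
proof -
  have cont: "continuous_on {x - 1..x + 1} std_normal_density"
    unfolding std_normal_density_def by (intro continuous_intros) auto
  have "((\<lambda>y. Phi (x - 1) + integral {x - 1..y} std_normal_density) has_real_derivative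
      std_normal_density x) (at x within {x - 1..x + 1})"
    by (auto intro!: derivative_eq_intros integral_has_real_derivative cont)
  then have "(Phi has_real_derivative std_normal_density x) (at x within {x - 1..x + 1})"
    by (rule has_field_derivative_transform_within[OF _ zero_less_one])
       (auto intro!: Phi_eq_add_integral[symmetric])
  then show ?thesis by (simp add: at_within_Icc_at)
qed

lemma DERIV_Phi' [derivative_intros]:
  assumes "(f has_real_derivative f') (at x within A)"
  shows "((\<lambda>x. Phi (f x)) has_real_derivative std_normal_density (f x) * f') (at x within A)"
  using DERIV_chain2[OF DERIV_Phi assms] .

lemma borel_measurable_Phi [measurable]: "Phi \<in> borel_measurable borel"
  by (intro borel_measurable_continuous_onI DERIV_continuous_on)
     (rule has_field_derivative_at_within[OF DERIV_Phi])

lemma Phi_nonneg: "0 \<le> Phi x" and Phi_le_1: "Phi x \<le> 1"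
  by (simp_all add: Phi_def cdf_def)

lemma tendsto_Phi_at_top: "(Phi \<longlongrightarrow> 1) at_top"
proof -
  interpret real_distribution stdn by (rule real_dist_normal_dist)
  show ?thesis unfolding Phi_def by (rule cdf_lim_at_top_prob)
qed

lemma tendsto_Phi_at_bot: "(Phi \<longlongrightarrow> 0) at_bot"
proof -
  interpret real_distribution stdn by (rule real_dist_normal_dist)
  show ?thesis unfolding Phi_def by (rule cdf_lim_at_bot)
qed

lemma tendsto_std_normal_density_at_top: "(std_normal_density \<longlongrightarrow> 0) at_top"
  unfolding std_normal_density_def by real_asymp

lemma std_normal_density_uminus [simp]: "std_normal_density (- x) = std_normal_density x"
  by (simp add: std_normal_density_def)

text \<open>Phi x + Phi (- x) has derivative zero because the density is even; its limit at infinity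
  identifies the constant.\<close>

lemma Phi_uminus: "Phi (- x) = 1 - Phi x"
proof -
  have "((\<lambda>x. Phi x + Phi (- x)) has_real_derivative 0) (at y)" for y
    by (auto intro!: derivative_eq_intros)
  then obtain c where c: "\<And>y. Phi y + Phi (- y) = c"
    using DERIV_isconst_all[of "\<lambda>x. Phi x + Phi (- x)"] by blast
  have "((\<lambda>x. Phi x + Phi (- x)) \<longlongrightarrow> 1 + 0) at_top"
    by (intro tendsto_add tendsto_Phi_at_top
        filterlim_compose[OF tendsto_Phi_at_bot filterlim_uminus_at_bot_at_top])
  then have "c = 1" unfolding c by (simp add: tendsto_const_iff)
  with c[of x] show ?thesis by simp
qed

lemma Phi_0: "Phi 0 = 1 / 2"
  using Phi_uminus[of 0] by simp

lemma G_eq: "G w \<beta> = G w 0 - \<beta> * w"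
  by (simp add: G_def)

lemma DERIV_G: "((\<lambda>w. G w \<beta>) has_real_derivative Phi w - \<beta>) (at w)"
  unfolding G_def by (auto intro!: derivative_eq_intros)

lemma borel_measurable_G [measurable]: "(\<lambda>w. G w \<beta>) \<in> borel_measurable borel"
  unfolding G_def by measurable

lemma deriv_G_0: "deriv (\<lambda>w. G w \<beta>) 0 = 1 / 2 - \<beta>"
  using DERIV_imp_deriv[OF DERIV_G[of \<beta> 0]] by (simp add: Phi_0)

text \<open>Expected form of max y 0 - y = max (- y) 0. It lets the right linear branch be handled
  as the left one with \<omega> and \<sigma> negated.\<close>

lemma G_reflect: "G w 0 - w = G (- w) 0"
  by (simp add: G_def Phi_uminus algebra_simps)

lemma integrable_stdn_ident [simp]: "integrable stdn (\<lambda>x. x)"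
  using integrable_std_normal_distribution_moment[of 1] by simp

lemma integrable_max_stdn: "integrable stdn (\<lambda>x. max (w + x) 0)"
  by (intro integrable_max) auto

text \<open>On the half-line from - w, the weighted integrand has the antiderivative w Phi x minus
  the density at x. The representation yields the sign of G and its stability under Gaussian
  smoothing.\<close>

lemma integral_max_stdn: "(\<integral>x. max (w + x) 0 \<partial>stdn) = G w 0"
proof -
  have deriv: "((\<lambda>x. w * Phi x - std_normal_density x) has_real_derivative
      (w + x) * std_normal_density x) (at x)" for x
    by (auto intro!: derivative_eq_intros simp: algebra_simps)
  have lim: "((\<lambda>x. w * Phi x - std_normal_density x) \<longlongrightarrow> w) at_top"
    using tendsto_diff[OF tendsto_mult[OF tendsto_const[of w] tendsto_Phi_at_top]
        tendsto_std_normal_density_at_top] by simp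
  \<comment> \<open>The antiderivative is nondecreasing from - w on, so its limit is at least its
    value there. The sign of G is needed because the nonnegative integral below determines the value
    only up to clipping at 0.\<close>
  have "w * Phi (- w) - std_normal_density (- w) \<le> w"
  proof (rule tendsto_lowerbound[OF lim])
    have "w * Phi (- w) - std_normal_density (- w) \<le> w * Phi x - std_normal_density x"
      if "- w \<le> x" for x
      using that
    proof (rule DERIV_nonneg_imp_nondecreasing)
      fix y assume "- w \<le> y"
      then have "0 \<le> (w + y) * std_normal_density y" by (intro mult_nonneg_nonneg) auto
      with deriv[of y] show "\<exists>d. ((\<lambda>x. w * Phi x - std_normal_density x) has_real_derivative d) (at y) \<and> 0 \<le> d"
        by blast
    qed
    then show "\<forall>\<^sub>F x in at_top. w * Phi (- w) - std_normal_density (- w) \<le> w * Phi x - std_normal_density x"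
      by (rule eventually_at_top_linorderI)
  qed simp
  then have G_nonneg: "0 \<le> G w 0" by (simp add: G_def Phi_uminus algebra_simps)
  have "(\<integral>\<^sup>+x. ennreal (max (w + x) 0) \<partial>stdn) =
      (\<integral>\<^sup>+x. ennreal (std_normal_density x) * ennreal (max (w + x) 0) \<partial>lborel)"
    by (subst nn_integral_density) auto
  also have "\<dots> = (\<integral>\<^sup>+x. ennreal ((w + x) * std_normal_density x) * indicator {- w ..} x \<partial>lborel)"
    by (intro nn_integral_cong)
       (auto simp: ennreal_mult[symmetric] max_def mult.commute split: split_indicator)
  also have "\<dots> = w - (w * Phi (- w) - std_normal_density (- w))"
    by (rule nn_integral_FTC_atLeast[OF _ deriv _ lim]) auto
  also have "\<dots> = ennreal (G w 0)"
    by (simp add: G_def Phi_uminus algebra_simps)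
  finally have "(\<integral>\<^sup>+x. ennreal (max (w + x) 0) \<partial>stdn) = ennreal (G w 0)" .
  moreover have "(\<integral>\<^sup>+x. ennreal (max (w + x) 0) \<partial>stdn) = ennreal (\<integral>x. max (w + x) 0 \<partial>stdn)"
    by (intro nn_integral_eq_integral integrable_max_stdn) auto
  moreover have "0 \<le> (\<integral>x. max (w + x) 0 \<partial>stdn)" by (intro integral_nonneg_AE) auto
  ultimately show ?thesis using G_nonneg by simp
qed

lemma G_nonneg: "0 \<le> G w 0"
  unfolding integral_max_stdn[symmetric] by (intro integral_nonneg_AE) auto

lemma G_le: "G w 0 \<le> 1 + max w 0"
proof -
  have "w * Phi w \<le> max w 0"
    using Phi_nonneg[of w] Phi_le_1[of w]
    by (cases "w \<ge> 0") (auto simp: mult_left_le mult_nonpos_nonneg max_def)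
  then show ?thesis using std_normal_density_le_1[of w] by (simp add: G_def)
qed

text \<open>Dropping the nonpositive term w Phi w leaves the density, and exp y \<ge> 1 + y turns
  its decay into a rational one, which is all that the linear branches need.\<close>

lemma G_le_of_nonpos:
  assumes "w \<le> 0"
  shows "G w 0 \<le> 2 / (2 + w\<^sup>2)"
proof -
  have "std_normal_density w \<le> exp (- w\<^sup>2 / 2)" by (rule std_normal_density_le_exp)
  also have "\<dots> = 1 / exp (w\<^sup>2 / 2)" by (simp add: exp_minus field_simps)
  also have "\<dots> \<le> 1 / (1 + w\<^sup>2 / 2)"
    by (intro divide_left_mono exp_ge_add_one_self) (auto intro!: mult_pos_pos add_pos_nonneg)
  finally have "std_normal_density w \<le> 2 / (2 + w\<^sup>2)" by (simp add: field_simps)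
  moreover have "w * Phi w \<le> 0" using assms Phi_nonneg[of w] by (rule mult_nonpos_nonneg)
  ultimately show ?thesis by (simp add: G_def)
qed

lemma abs_G_le:
  assumes "0 \<le> \<beta>" "\<beta> \<le> 1"
  shows "\<bar>G w \<beta>\<bar> \<le> 1 + \<bar>w\<bar>"
proof -
  have "\<bar>\<beta> * w\<bar> \<le> \<bar>w\<bar>" using assms by (simp add: abs_mult mult_left_le_one_le)
  moreover have "(1 - \<beta>) * w \<le> \<bar>w\<bar>"
    using mult_left_le_one_le[of "\<bar>w\<bar>" "1 - \<beta>"] mult_left_mono[of w "\<bar>w\<bar>" "1 - \<beta>"]
      abs_ge_self[of w] assms by linarith
  ultimately show ?thesis
    using G_nonneg[of w] G_le[of w] G_eq[of w \<beta>]
    by (auto simp: max_def algebra_simps abs_le_iff split: if_splits)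
qed

text \<open>Beyond t the indicator is at most x / t, and x times the density integrates exactly. The
  factor 1 / t is essential: it survives the multiplication by n when t = sqrt(2 log n).\<close>

lemma stdn_tail_le:
  assumes "0 < t"
  shows "measure stdn {x. t < \<bar>x\<bar>} \<le> 2 * exp (- t\<^sup>2 / 2) / t"
proof -
  have "(\<integral>\<^sup>+x. ennreal (std_normal_density x * x) * indicator {t ..} x \<partial>lborel) =
      0 - (- std_normal_density t)"
    using assms tendsto_minus[OF tendsto_std_normal_density_at_top]
    by (intro nn_integral_FTC_atLeast) (auto intro!: derivative_eq_intros simp: mult.commute)
  moreover have "emeasure stdn {t<..} \<le> (\<integral>\<^sup>+x. ennreal (x / t) * indicator {t ..} x \<partial>stdn)"
  proof -
    have "emeasure stdn {t<..} = (\<integral>\<^sup>+x. indicator {t<..} x \<partial>stdn)" by simp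
    also have "\<dots> \<le> (\<integral>\<^sup>+x. ennreal (x / t) * indicator {t ..} x \<partial>stdn)"
    proof (intro nn_integral_mono)
      fix x
      have "1 \<le> ennreal (x / t)" if "t < x"
        using that assms by (subst ennreal_1[symmetric], intro ennreal_leI) simp
      then show "indicator {t<..} x \<le> ennreal (x / t) * indicator {t ..} x"
        by (auto split: split_indicator)
    qed
    finally show ?thesis .
  qed
  moreover have "(\<integral>\<^sup>+x. ennreal (x / t) * indicator {t ..} x \<partial>stdn) =
      ennreal (1 / t) * (\<integral>\<^sup>+x. ennreal (std_normal_density x * x) * indicator {t ..} x \<partial>lborel)"
    using assms
    by (subst nn_integral_density, simp_all, subst nn_integral_cmult[symmetric])
       (auto intro!: nn_integral_cong simp: ennreal_mult[symmetric] split: split_indicator)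
  ultimately have "emeasure stdn {t<..} \<le> ennreal (std_normal_density t / t)"
    using assms by (simp add: ennreal_mult[symmetric])
  then have right: "measure stdn {t<..} \<le> std_normal_density t / t"
    using assms by (simp add: stdn.emeasure_eq_measure)
  have "measure stdn {..<- t} = measure (distr stdn borel uminus) {..<- t}"
    by (simp add: distr_uminus_stdn)
  also have "\<dots> = measure stdn {t<..}"
    by (subst measure_distr) (auto intro!: arg_cong[where f="measure stdn"])
  finally have left: "measure stdn {..<- t} \<le> std_normal_density t / t" using right by simp
  have "{x. t < \<bar>x\<bar>} = {t<..} \<union> {..<- t}" by auto
  then have "measure stdn {x. t < \<bar>x\<bar>} \<le> measure stdn {t<..} + measure stdn {..<- t}"
    by (simp add: measure_Un_le)
  also have "\<dots> \<le> 2 * std_normal_density t / t" using left right by simp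
  also have "\<dots> \<le> 2 * exp (- t\<^sup>2 / 2) / t"
    using assms std_normal_density_le_exp[of t] by (intro divide_right_mono) auto
  finally show ?thesis .
qed

text \<open>Chebyshev's inequality in a form that remains valid when the scale \<open>\<sigma>\<close> vanishes.\<close>

lemma stdn_chebyshev:
  assumes "0 < t"
  shows "measure stdn {x. t \<le> \<bar>\<sigma> * x\<bar>} \<le> \<sigma>\<^sup>2 / t\<^sup>2"
proof -
  have "measure stdn {x. t \<le> \<bar>\<sigma> * x\<bar>} = (\<integral>x. indicator {x. t \<le> \<bar>\<sigma> * x\<bar>} x \<partial>stdn)"
    by simp
  also have "\<dots> \<le> (\<integral>x. \<sigma>\<^sup>2 / t\<^sup>2 * x\<^sup>2 \<partial>stdn)"
  proof (intro integral_mono)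
    show "integrable stdn (\<lambda>x. \<sigma>\<^sup>2 / t\<^sup>2 * x\<^sup>2)"
      by (intro integrable_mult_right integrable_std_normal_distribution_moment)
    fix x
    show "indicator {x. t \<le> \<bar>\<sigma> * x\<bar>} x \<le> \<sigma>\<^sup>2 / t\<^sup>2 * x\<^sup>2"
    proof (cases "t \<le> \<bar>\<sigma> * x\<bar>")
      case True
      then have "t\<^sup>2 \<le> (\<sigma> * x)\<^sup>2" using assms by (intro abs_le_square_iff[THEN iffD1]) auto
      with True assms show ?thesis by (simp add: field_simps)
    qed simp
  qed (auto simp: integrable_indicator_iff stdn.emeasure_eq_measure)
  also have "\<dots> = \<sigma>\<^sup>2 / t\<^sup>2"
    using std_normal_distribution_even_moments(1)[of 1] by simp
  finally show ?thesis .
qed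


text \<open>
  The first \<open>L\<close> terms of the expansion of \<open>w \<mapsto> G w \<beta>\<close> beyond the linear part, with the
  monomials replaced by Hermite polynomials of variance \<open>v\<close>; \<open>v = 0\<close> gives the Taylor polynomial.
\<close>

definition G_series :: "real \<Rightarrow> real \<Rightarrow> nat \<Rightarrow> real poly" where
  "G_series \<beta> v L = [:std_normal_density 0, 1 / 2 - \<beta>:] +
     (\<Sum>k<L. smult (std_normal_density 0 * ((-1) ^ k * hermite k 0 / fact (k + 2)))
       (hermite_poly v (k + 2)))"

lemma poly_G_series:
  "poly (G_series \<beta> v L) u = std_normal_density 0 + (1 / 2 - \<beta>) * poly (hermite_poly v 1) u +
     (\<Sum>k<L. std_normal_density 0 * ((-1) ^ k * hermite k 0 / fact (k + 2)) *
       poly (hermite_poly v (k + 2)) u)"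
  by (simp add: G_series_def poly_sum mult.commute del: hermite_poly.simps(2) add: hermite_poly.simps(2)[of v 0])

lemma S_trunc_eq_poly:
  "S_trunc \<beta> \<nu>p \<nu>f \<gamma> n \<tau> u =
    poly (G_series \<beta> ((s_coef \<nu>p \<nu>f \<tau>)\<^sup>2) (K_trunc \<gamma> \<nu>p \<nu>f n - 1)) u"
  by (simp only: S_trunc_def G_series_def hermite_scaled_eq_poly deriv_G_0 poly_add poly_sum
      poly_smult sum_distrib_left mult.assoc) (simp add: G_def mult.commute)

lemma hermite_poly_0_eq: "hermite_poly 0 m = monom 1 m"
proof (induction m)
  case (Suc m)
  then show ?case by (simp add: monom_Suc)
qed simp

lemma integral_G_series:
  "(\<integral>x. poly (G_series \<beta> (b\<^sup>2) L) (a + b * x) \<partial>stdn) = poly (G_series \<beta> 0 L) a"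
proof -
  have "(\<integral>x. poly (G_series \<beta> (b\<^sup>2) L) (a + b * x) \<partial>stdn) =
    (\<integral>x. std_normal_density 0 + (1 / 2 - \<beta>) * poly (hermite_poly (b\<^sup>2) 1) (a + b * x) \<partial>stdn) +
     (\<Sum>k<L. (\<integral>x. std_normal_density 0 * ((-1) ^ k * hermite k 0 / fact (k + 2)) *
       poly (hermite_poly (b\<^sup>2) (k + 2)) (a + b * x) \<partial>stdn))"
    unfolding poly_G_series
    by (subst Bochner_Integration.integral_add)
       (auto intro!: Bochner_Integration.integrable_sum Bochner_Integration.integrable_add
          Bochner_Integration.integral_sum integrable_mult_right
        simp del: hermite_poly.simps add_2_eq_Suc')
  also have "(\<integral>x. std_normal_density 0 + (1 / 2 - \<beta>) * poly (hermite_poly (b\<^sup>2) 1) (a + b * x) \<partial>stdn) =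
      std_normal_density 0 + (1 / 2 - \<beta>) * a ^ 1"
    by (subst Bochner_Integration.integral_add)
       (use stdn.prob_space in \<open>auto simp: integral_hermite_poly simp del: hermite_poly.simps One_nat_def\<close>)
  also have "std_normal_density 0 + (1 / 2 - \<beta>) * a ^ 1 + (\<Sum>k<L. (\<integral>x. std_normal_density 0 * ((-1) ^ k * hermite k 0 / fact (k + 2)) *
       poly (hermite_poly (b\<^sup>2) (k + 2)) (a + b * x) \<partial>stdn)) = poly (G_series \<beta> 0 L) a"
    unfolding poly_G_series hermite_poly_0_eq Bochner_Integration.integral_mult_right_zero
      integral_hermite_poly poly_monom by (simp only: mult_1)
  finally show ?thesis .
qed

text \<open>Cauchy-Schwarz over the L + 2 terms avoids cross moments and costs one factor L + 2;
  summing the terms costs the other. Each term is at most the exponential, since c_k^2 \<le> 1/k!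
  and y^k \<le> k! exp y with y = a^2 + k b^2.\<close>

lemma integral_G_series_sq_le:
  assumes "0 \<le> \<beta>" "\<beta> \<le> 1"
  shows "(\<integral>x. (poly (G_series \<beta> (b\<^sup>2) L) (a + b * x))\<^sup>2 \<partial>stdn) \<le>
    (real (L + 2))\<^sup>2 * exp (a\<^sup>2 + real (L + 1) * b\<^sup>2)"
proof -
  \<comment> \<open>Absorbs the constant and the linear term into one sum, as the coefficients of
    degrees 0 and 1.\<close>
  define c where "c k = (if k = 0 then std_normal_density 0 else if k = 1 then 1 / 2 - \<beta> else
      std_normal_density 0 * ((-1) ^ (k - 2) * hermite (k - 2) 0 / fact k))" for k :: nat
  have S: "poly (G_series \<beta> v L) u = (\<Sum>k<L + 2. c k * poly (hermite_poly v k) u)" for v u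
    unfolding poly_G_series c_def
    by (simp only: sum.lessThan_Suc_shift add_2_eq_Suc' o_def)
       (simp del: hermite_poly.simps(2) fact_Suc)
  have c: "(c k)\<^sup>2 * a ^ k \<le> exp a" if "0 \<le> a" for a k
  proof -
    have "(c k)\<^sup>2 \<le> 1 / fact k"
    proof -
      consider "k = 0" | "k = 1" | l where "k = l + 2"
        by (metis One_nat_def Suc_eq_plus1 add_2_eq_Suc' not0_implies_Suc)
      then show ?thesis
      proof cases
        case 1
        then show ?thesis using std_normal_density_le_1[of 0]
          by (simp add: c_def power_le_one)
      next
        case 2
        have "(1 / 2 - \<beta>)\<^sup>2 \<le> 1\<^sup>2" using assms by (intro abs_le_square_iff[THEN iffD1]) auto
        then show ?thesis using 2 by (simp add: c_def)
      next
        case 3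
        have "(c k)\<^sup>2 = (std_normal_density 0)\<^sup>2 * ((hermite l 0)\<^sup>2 / (fact k * fact k))"
          by (simp add: 3 c_def power_mult_distrib power_divide power2_eq_square[of "fact k"] del: fact_Suc add_2_eq_Suc')
             (simp add: power2_eq_square)
        also have "\<dots> \<le> 1 * (fact k / (fact k * fact k))"
        proof (intro mult_mono divide_right_mono)
          show "(std_normal_density 0)\<^sup>2 \<le> 1"
            using std_normal_density_le_1[of 0] by (simp add: power_le_one)
          have "fact l \<le> (fact k :: real)" unfolding 3 by (rule fact_mono) simp
          then show "(hermite l 0)\<^sup>2 \<le> fact k" using hermite_0_sq_le[of l] by linarith
        qed auto
        finally show ?thesis by simp
      qed
    qed
    then have "(c k)\<^sup>2 * a ^ k \<le> 1 / fact k * (fact k * exp a)"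
      using power_le_fact_mult_exp[OF that] that by (intro mult_mono) auto
    then show ?thesis by simp
  qed
  have int: "integrable stdn (\<lambda>x. (poly p (a + b * x))\<^sup>2)" for p
    using integrable_poly_stdn[of "p\<^sup>2" a b] by simp
  have "(\<integral>x. (poly (G_series \<beta> (b\<^sup>2) L) (a + b * x))\<^sup>2 \<partial>stdn) \<le>
      (\<integral>x. real (L + 2) * (\<Sum>k<L + 2. (c k)\<^sup>2 * (poly (hermite_poly (b\<^sup>2) k) (a + b * x))\<^sup>2) \<partial>stdn)"
  proof (rule integral_mono)
    fix x
    show "(poly (G_series \<beta> (b\<^sup>2) L) (a + b * x))\<^sup>2 \<le>
      real (L + 2) * (\<Sum>k<L + 2. (c k)\<^sup>2 * (poly (hermite_poly (b\<^sup>2) k) (a + b * x))\<^sup>2)"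
      using Cauchy_Schwarz_ineq_sum[of "\<lambda>_. 1" "\<lambda>k. c k * poly (hermite_poly (b\<^sup>2) k) (a + b * x)" "{..<L + 2}"]
      unfolding S by (simp only: mult_1 power_one sum_constant card_lessThan power_mult_distrib mult_1_right)
  qed (intro int integrable_mult_right Bochner_Integration.integrable_sum)+
  also have "\<dots> = real (L + 2) * (\<Sum>k<L + 2. (c k)\<^sup>2 * (\<integral>x. (poly (hermite_poly (b\<^sup>2) k) (a + b * x))\<^sup>2 \<partial>stdn))"
    by (subst Bochner_Integration.integral_mult_right_zero, subst Bochner_Integration.integral_sum)
       (simp_all only: int integrable_mult_right Bochner_Integration.integral_mult_right_zero)
  also have "\<dots> \<le> real (L + 2) * (\<Sum>k<L + 2. (c k)\<^sup>2 * (a\<^sup>2 + real k * b\<^sup>2) ^ k)"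
    by (intro mult_left_mono sum_mono integral_hermite_poly_sq_le) auto
  also have "\<dots> \<le> real (L + 2) * (\<Sum>k<L + 2. exp (a\<^sup>2 + real (L + 1) * b\<^sup>2))"
  proof (intro mult_left_mono sum_mono)
    fix k assume "k \<in> {..<L + 2}"
    then have "real k * b\<^sup>2 \<le> real (L + 1) * b\<^sup>2" by (intro mult_right_mono) auto
    then have "exp (a\<^sup>2 + real k * b\<^sup>2) \<le> exp (a\<^sup>2 + real (L + 1) * b\<^sup>2)" by simp
    then show "(c k)\<^sup>2 * (a\<^sup>2 + real k * b\<^sup>2) ^ k \<le> exp (a\<^sup>2 + real (L + 1) * b\<^sup>2)"
      by (rule order.trans[OF c, rotated]) simp
  qed simp
  also have "\<dots> = (real (L + 2))\<^sup>2 * exp (a\<^sup>2 + real (L + 1) * b\<^sup>2)"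
    by (simp only: sum_constant card_lessThan power2_eq_square mult.assoc)
  finally show ?thesis .
qed

section \<open>Taylor remainder of G\<close>

lemma hermite_even_0: "hermite (2 * j) 0 = (-1) ^ j * fact (2 * j) / (2 ^ j * fact j)"
  and hermite_odd_0: "hermite (2 * j + 1) 0 = 0"
proof (induction j)
  case (Suc j)
  {
    case 1
    have "hermite (2 * Suc j) 0 = - (real (2 * j + 1) * ((-1) ^ j * fact (2 * j) / (2 ^ j * fact j)))"
      using Suc.IH(1) by simp
    also have "\<dots> = (-1) ^ Suc j * ((2 * real (Suc j)) * (real (2 * j + 1) * fact (2 * j))) /
        ((2 * real (Suc j)) * (2 ^ j * fact j))"
      unfolding mult.left_commute[of "(-1) ^ Suc j" "2 * real (Suc j)"]
      by (subst mult_divide_mult_cancel_left) simp_all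
    also have "(2 * real (Suc j)) * (real (2 * j + 1) * fact (2 * j)) = fact (2 * Suc j)"
      by (simp add: algebra_simps)
    also have "(2 * real (Suc j)) * (2 ^ j * fact j) = 2 ^ Suc j * fact (Suc j)"
      by (simp add: algebra_simps)
    finally show ?case .
  next
    case 2
    then show ?case using Suc.IH(2) by simp
  }
qed simp_all

text \<open>The odd Hermite values at 0 vanish, and the even ones produce the exponential series at
  - x^2 / 2; (L + 1) div 2 counts the even k < L.\<close>

lemma hermite_0_sum_eq:
  "(\<Sum>k<L. (-1) ^ k * hermite k 0 / fact k * x ^ k) =
    (\<Sum>j<(L + 1) div 2. (- (x\<^sup>2 / 2)) ^ j / fact j)"
proof (induction L)
  case (Suc L)
  show ?case
  proof (cases "even L")
    case True
    then obtain j where j: "L = 2 * j" by blast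
    have "(-1) ^ L * hermite L 0 / fact L * x ^ L = (-1) ^ j / (2 ^ j * fact j) * (x\<^sup>2) ^ j"
      unfolding j hermite_even_0 by (simp add: power_mult)
    also have "\<dots> = (- (x\<^sup>2 / 2)) ^ j / fact j"
      by (simp add: power_minus[of "x\<^sup>2 / 2"] power_divide)
    finally show ?thesis using Suc.IH by (simp add: j)
  next
    case False
    then obtain j where j: "L = 2 * j + 1" by (elim oddE)
    then show ?thesis using Suc.IH hermite_odd_0[of j] by simp
  qed
qed simp

text \<open>Lagrange's remainder is evaluated at a negative point, where exp is at most 1, so no
  factor exp y appears. The degenerate cases y = 0 and J = 0 are treated apart.\<close>

lemma exp_minus_remainder_le:
  fixes y :: real
  assumes "0 \<le> y"
  shows "\<bar>exp (- y) - (\<Sum>j<J. (- y) ^ j / fact j)\<bar> \<le> y ^ J / fact J"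
proof (cases "y = 0 \<or> J = 0")
  case True
  then show ?thesis
  proof
    assume "y = 0"
    then show ?thesis by (cases J) (simp_all add: sum.lessThan_Suc_shift del: sum.lessThan_Suc)
  qed (use assms in simp)
next
  case False
  then have "\<exists>t>- y. t < 0 \<and> exp (- y) =
      (\<Sum>m<J. (\<lambda>_. exp) m 0 / fact m * (- y) ^ m) + (\<lambda>_. exp) J t / fact J * (- y) ^ J"
    using assms by (intro Maclaurin_minus) (auto intro!: derivative_eq_intros)
  then obtain t where t: "t < 0"
    "exp (- y) = (\<Sum>j<J. (- y) ^ j / fact j) + exp t / fact J * (- y) ^ J" by auto
  have "\<bar>exp t / fact J * (- y) ^ J\<bar> = exp t * (y ^ J / fact J)"
    using assms by (simp add: abs_mult power_abs)
  also have "\<dots> \<le> 1 * (y ^ J / fact J)"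
    using t(1) assms by (intro mult_right_mono) auto
  finally show ?thesis using t(2) by simp
qed

lemma DERIV_power_div_fact:
  "((\<lambda>x. x ^ Suc k / fact (Suc k)) has_real_derivative x ^ k / fact k) (at x)"
  using DERIV_cdivide[OF DERIV_pow[of "Suc k"], of "fact (Suc k)" x UNIV]
  by (simp add: divide_simps)

text \<open>Twice differentiating reduces the remainder of \<open>G\<close> to that of the exponential series.\<close>

lemma abs_G_minus_series_le:
  assumes "J = (L + 1) div 2"
  shows "\<bar>G w \<beta> - poly (G_series \<beta> 0 L) w\<bar> \<le> w\<^sup>2 * ((w\<^sup>2 / 2) ^ J / fact J)"
proof -
  let ?c = "\<lambda>k. std_normal_density 0 * ((-1) ^ k * hermite k 0)"
  \<comment> \<open>\<open>D 0\<close>, \<open>D 1\<close>, \<open>D 2\<close> are the remainder and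
    its first two derivatives.\<close>
  define D where "D m x = (if m = 0 then G x \<beta> - (std_normal_density 0 + (1 / 2 - \<beta>) * x +
        (\<Sum>k<L. ?c k * (x ^ (Suc (Suc k)) / fact (Suc (Suc k)))))
      else if m = 1 then Phi x - \<beta> - ((1 / 2 - \<beta>) + (\<Sum>k<L. ?c k * (x ^ Suc k / fact (Suc k))))
      else std_normal_density x - (\<Sum>k<L. ?c k * (x ^ k / fact k)))" for m :: nat and x
  have D0: "G x \<beta> - poly (G_series \<beta> 0 L) x = D 0 x" for x
    unfolding poly_G_series hermite_poly_0_eq poly_monom D_def
    by (simp add: mult.commute mult.left_commute del: fact_Suc power_Suc)
  have sums: "((\<lambda>x. \<Sum>k<L. ?c k * (x ^ Suc (f k) / fact (Suc (f k)))) has_real_derivative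
      (\<Sum>k<L. ?c k * (x ^ f k / fact (f k)))) (at x)" for x :: real and f :: "nat \<Rightarrow> nat"
    by (intro DERIV_sum DERIV_cmult DERIV_power_div_fact)
  \<comment> \<open>Second-order Maclaurin formula; both lower coefficients turn out to vanish,
    since the series matches G and its slope at 0.\<close>
  have "\<exists>t. \<bar>t\<bar> \<le> \<bar>w\<bar> \<and> D 0 w = (\<Sum>m<2. D m 0 / fact m * w ^ m) + D 2 t / fact 2 * w ^ 2"
  proof (rule Maclaurin_bi_le[OF refl], safe)
    fix m :: nat and t :: real
    assume "m < 2"
    then consider "m = 0" | "m = 1" by linarith
    then show "(D m has_real_derivative D (Suc m) t) (at t)"
    proof cases
      case 1
      have "((\<lambda>x. std_normal_density 0 + (1 / 2 - \<beta>) * x) has_real_derivative 1 / 2 - \<beta>) (at t)"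
        by (auto intro!: derivative_eq_intros)
      from DERIV_diff[OF DERIV_G[of \<beta>] DERIV_add[OF this sums[of Suc]]]
      show ?thesis unfolding 1 D_def by (simp del: fact_Suc power_Suc)
    next
      case 2
      have "((\<lambda>x. Phi x - \<beta>) has_real_derivative std_normal_density t) (at t)"
        "((\<lambda>x. 1 / 2 - \<beta>) has_real_derivative 0) (at t)"
        by (auto intro!: derivative_eq_intros)
      from DERIV_diff[OF this(1) DERIV_add[OF this(2) sums[of "\<lambda>k. k"]]]
      show ?thesis unfolding 2 D_def by (simp del: fact_Suc power_Suc)
    qed
  qed
  moreover have "D 0 0 = 0" "D 1 0 = 0"
    by (simp_all add: D_def G_def Phi_0)
  ultimately obtain t where t: "\<bar>t\<bar> \<le> \<bar>w\<bar>" "D 0 w = D 2 t / 2 * w\<^sup>2"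
    by (auto simp: numeral_2_eq_2)
  have tw: "t\<^sup>2 / 2 \<le> w\<^sup>2 / 2" using t(1) by (simp add: abs_le_square_iff)
  have "D 2 t = std_normal_density 0 * exp (- (t\<^sup>2 / 2)) -
      std_normal_density 0 * (\<Sum>k<L. (-1) ^ k * hermite k 0 / fact k * t ^ k)"
    by (simp add: D_def sum_distrib_left std_normal_density_def mult.assoc)
  also have "\<dots> = std_normal_density 0 * (exp (- (t\<^sup>2 / 2)) - (\<Sum>j<J. (- (t\<^sup>2 / 2)) ^ j / fact j))"
    unfolding hermite_0_sum_eq assms by (simp add: right_diff_distrib)
  finally have "\<bar>D 2 t\<bar> = std_normal_density 0 * \<bar>exp (- (t\<^sup>2 / 2)) - (\<Sum>j<J. (- (t\<^sup>2 / 2)) ^ j / fact j)\<bar>"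
    by (simp add: abs_mult)
  also have "\<dots> \<le> 1 * ((t\<^sup>2 / 2) ^ J / fact J)"
    by (intro mult_mono exp_minus_remainder_le std_normal_density_le_1) auto
  also have "\<dots> \<le> (w\<^sup>2 / 2) ^ J / fact J"
    using tw by (simp add: divide_right_mono power_mono)
  finally have "\<bar>D 2 t\<bar> / 2 \<le> (w\<^sup>2 / 2) ^ J / fact J"
    using abs_ge_zero[of "D 2 t"] by linarith
  from mult_right_mono[OF this, of "w\<^sup>2"]
  have "\<bar>D 0 w\<bar> \<le> (w\<^sup>2 / 2) ^ J / fact J * w\<^sup>2"
    unfolding t(2) by (simp add: abs_mult)
  then show ?thesis by (simp add: D0 mult.commute)
qed

section \<open>The estimator in rotated coordinates\<close>

lemma measure_stdn_UNIV [simp]: "measure stdn UNIV = 1"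
  using stdn.prob_space by simp

lemma integral_stdn_ident [simp]: "(\<integral>x. x \<partial>stdn) = 0"
  using integral_std_normal_distribution_moment_odd[of 1] by simp

lemma stdn2_integral_mult:
  fixes f g :: "real \<Rightarrow> real"
  assumes f: "integrable stdn f" and g: "integrable stdn g"
  shows "integrable (stdn \<Otimes>\<^sub>M stdn) (\<lambda>(a, b). f a * g b)"
    and "(\<integral>(a, b). f a * g b \<partial>(stdn \<Otimes>\<^sub>M stdn)) = (\<integral>a. f a \<partial>stdn) * (\<integral>b. g b \<partial>stdn)"
proof -
  have [measurable]: "f \<in> borel_measurable borel" "g \<in> borel_measurable borel"
    using f g by (auto dest: borel_measurable_integrable)
  show i: "integrable (stdn \<Otimes>\<^sub>M stdn) (\<lambda>(a, b). f a * g b)"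
  proof (rule stdn2.Fubini_integrable)
    show "integrable stdn (\<lambda>a. \<integral>b. norm (case (a, b) of (a, b) \<Rightarrow> f a * g b) \<partial>stdn)"
      using f by (simp add: abs_mult)
    show "AE a in stdn. integrable stdn (\<lambda>b. case (a, b) of (a, b) \<Rightarrow> f a * g b)"
      using g by simp
  qed measurable
  show "(\<integral>(a, b). f a * g b \<partial>(stdn \<Otimes>\<^sub>M stdn)) = (\<integral>a. f a \<partial>stdn) * (\<integral>b. g b \<partial>stdn)"
    using stdn2.integral_fst'[OF i] by simp
qed

lemma integrable_indicator_stdn:
  "B \<in> sets borel \<Longrightarrow> integrable stdn (indicat_real B)"
  by (simp add: integrable_indicator_iff stdn.emeasure_eq_measure)

text \<open>A function of (a, b) whose formula in a is selected by b is a sum of products, so the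
  double integral factorizes. Both \<open>T_uv\<close> and its squared error have this form. The
  third region is a set of its own so that it can be written in mirrored form.\<close>

lemma stdn2_integral_cases:
  fixes f1 f2 f3 :: "real \<Rightarrow> real"
  assumes f: "integrable stdn f1" "integrable stdn f2" "integrable stdn f3"
    and B: "B1 \<in> sets borel" "B2 \<in> sets borel" "B3 \<in> sets borel"
    and disj: "B1 \<inter> B2 = {}" and B3: "B3 = - (B1 \<union> B2)"
    and h: "\<And>a b. h a b = (if b \<in> B1 then f1 a else if b \<in> B2 then f2 a else f3 a)"
  shows "integrable (stdn \<Otimes>\<^sub>M stdn) (\<lambda>(a, b). h a b)"
    and "(\<integral>(a, b). h a b \<partial>(stdn \<Otimes>\<^sub>M stdn)) =
      (\<integral>a. f1 a \<partial>stdn) * measure stdn B1 + (\<integral>a. f2 a \<partial>stdn) * measure stdn B2 +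
      (\<integral>a. f3 a \<partial>stdn) * measure stdn B3"
proof -
  have eq: "(\<lambda>(a, b). h a b) = (\<lambda>x. (case x of (a, b) \<Rightarrow> f1 a * indicator B1 b) +
      (case x of (a, b) \<Rightarrow> f2 a * indicator B2 b) + (case x of (a, b) \<Rightarrow> f3 a * indicator B3 b))"
    using disj B3 by (auto simp: fun_eq_iff h indicator_def)
  note i = stdn2_integral_mult[OF f(1) integrable_indicator_stdn[OF B(1)]]
    stdn2_integral_mult[OF f(2) integrable_indicator_stdn[OF B(2)]]
    stdn2_integral_mult[OF f(3) integrable_indicator_stdn[OF B(3)]]
  show "integrable (stdn \<Otimes>\<^sub>M stdn) (\<lambda>(a, b). h a b)"
    unfolding eq by (intro Bochner_Integration.integrable_add i)
  show "(\<integral>(a, b). h a b \<partial>(stdn \<Otimes>\<^sub>M stdn)) =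
      (\<integral>a. f1 a \<partial>stdn) * measure stdn B1 + (\<integral>a. f2 a \<partial>stdn) * measure stdn B2 +
      (\<integral>a. f3 a \<partial>stdn) * measure stdn B3"
    unfolding eq using i B
    by (simp add: Bochner_Integration.integral_add Bochner_Integration.integrable_add)
qed

text \<open>Either \<omega> lies below - \<rho> / 2, where G is already of order 1 / \<rho>^2, or
  the event forces a deviation of at least y = \<rho> + \<omega>, whose Chebyshev probability 1 /
  y^2 beats the linear growth of G.\<close>

lemma G_mult_left_tail_le:
  assumes "1 \<le> \<rho>" "\<sigma>\<^sup>2 \<le> 1"
  shows "G \<omega> 0 * measure stdn {b. \<omega> + \<sigma> * b < - \<rho>} \<le> 8 / \<rho>"
    and "(G \<omega> 0)\<^sup>2 * measure stdn {b. \<omega> + \<sigma> * b < - \<rho>} \<le> 9"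
proof -
  let ?p = "measure stdn {b. \<omega> + \<sigma> * b < - \<rho>}"
  have p1: "?p \<le> 1" by simp
  have "G \<omega> 0 * ?p \<le> 8 / \<rho> \<and> (G \<omega> 0)\<^sup>2 * ?p \<le> 9"
  proof (cases "\<omega> \<le> - \<rho> / 2")
    case True
    have sq: "\<rho>\<^sup>2 / 4 \<le> \<omega>\<^sup>2"
      using power_mono[of "\<rho> / 2" "- \<omega>" 2] True assms(1) by (simp add: power_divide)
    have "G \<omega> 0 \<le> 2 / (2 + \<omega>\<^sup>2)" using True assms(1) by (intro G_le_of_nonpos) simp
    also have "\<dots> \<le> 2 / (\<rho>\<^sup>2 / 4)" using sq assms(1) by (intro divide_left_mono) (auto intro!: mult_pos_pos add_pos_nonneg)
    also have "\<dots> \<le> 8 / \<rho>"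
      using assms(1) by (simp add: power2_eq_square field_simps)
    finally have 1: "G \<omega> 0 \<le> 8 / \<rho>" .
    have 2: "G \<omega> 0 \<le> 1" using G_le[of \<omega>] True assms(1) by simp
    have "G \<omega> 0 * ?p \<le> 8 / \<rho> * 1"
      using 1 p1 assms(1) by (intro mult_mono) auto
    moreover have "(G \<omega> 0)\<^sup>2 * ?p \<le> 1 * 1"
      using 2 p1 G_nonneg[of \<omega>] by (intro mult_mono power_le_one) auto
    ultimately show ?thesis by auto
  next
    case False
    define y where "y = \<rho> + \<omega>"
    \<comment> \<open>As \<omega> > - \<rho> / 2, the distance y is at least half the threshold and
      dominates |\<omega>|, so that 1 + y bounds G.\<close>
    have y: "\<rho> / 2 \<le> y" "1 / 2 \<le> y" "\<bar>\<omega>\<bar> \<le> y" using False assms(1) by (auto simp: y_def)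
    have "?p \<le> measure stdn {b. y \<le> \<bar>\<sigma> * b\<bar>}"
      by (intro stdn.finite_measure_mono) (auto simp: y_def)
    also have "\<dots> \<le> \<sigma>\<^sup>2 / y\<^sup>2" using y by (intro stdn_chebyshev) simp
    also have "\<dots> \<le> 1 / y\<^sup>2" using assms(2) by (intro divide_right_mono) auto
    finally have p: "?p \<le> 1 / y\<^sup>2" .
    have g: "G \<omega> 0 \<le> 1 + y" using G_le[of \<omega>] y(3) by auto
    have "G \<omega> 0 * ?p \<le> (1 + y) * (1 / y\<^sup>2)" using g p y by (intro mult_mono) auto
    also have "\<dots> = 1 / y * (1 / y) + 1 / y" using y by (simp add: field_simps power2_eq_square)
    also have "\<dots> \<le> 2 * (2 / \<rho>) + 2 / \<rho>"
    proof -
      have "1 / y \<le> 2" "1 / y \<le> 2 / \<rho>" using y assms(1) by (auto simp: field_simps)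
      then show ?thesis using y assms(1) by (intro add_mono mult_mono) auto
    qed
    also have "\<dots> \<le> 8 / \<rho>" using assms(1) by (simp add: field_simps)
    finally have 1: "G \<omega> 0 * ?p \<le> 8 / \<rho>" .
    have "(G \<omega> 0)\<^sup>2 * ?p \<le> (1 + y)\<^sup>2 * (1 / y\<^sup>2)"
      using g p y G_nonneg[of \<omega>] by (intro mult_mono power_mono) auto
    also have "\<dots> = ((1 + y) / y)\<^sup>2" by (simp add: power_divide)
    also have "\<dots> \<le> 3\<^sup>2" using y by (intro power_mono) (auto simp: field_simps)
    finally show ?thesis using 1 by simp
  qed
  then show "G \<omega> 0 * ?p \<le> 8 / \<rho>" "(G \<omega> 0)\<^sup>2 * ?p \<le> 9" by auto
qed

text \<open>The distance y = |\<omega>| - \<gamma> t from \<omega> to the middle interval exceeds s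
  t. The exponential tail is meant to cancel the truncation level, whereas Chebyshev's bound (s /
  y)^2 decays in \<omega> and so controls the unbounded factor 1 + |\<omega>|.\<close>

lemma middle_prob_le:
  assumes "0 < s" "\<bar>\<sigma>\<bar> \<le> s" "s \<le> 1" "0 \<le> \<gamma>" "\<gamma> \<le> 1" "1 \<le> t" "(\<gamma> + s) * t < \<bar>\<omega>\<bar>"
  defines "p \<equiv> measure stdn {b. \<bar>\<omega> + \<sigma> * b\<bar> \<le> \<gamma> * t}"
  shows "p \<le> 2 * exp (- t\<^sup>2 / 2) / t" "(1 + \<bar>\<omega>\<bar>) * p \<le> 3 / t" "(1 + \<bar>\<omega>\<bar>)\<^sup>2 * p \<le> 9"
proof -
  define y where "y = \<bar>\<omega>\<bar> - \<gamma> * t"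
  have y: "s * t < y" using assms(7) by (simp add: y_def distrib_right)
  have y0: "0 < y" using y assms(1,6) by (smt (verit) mult_pos_pos)
  have dev: "y \<le> \<bar>\<sigma> * b\<bar>" if "\<bar>\<omega> + \<sigma> * b\<bar> \<le> \<gamma> * t" for b
    using that by (simp add: y_def)
  have "t < \<bar>b\<bar>" if "\<bar>\<omega> + \<sigma> * b\<bar> \<le> \<gamma> * t" for b
  proof -
    have "s * t < \<bar>\<sigma>\<bar> * \<bar>b\<bar>" using dev[OF that] y by (simp add: abs_mult)
    also have "\<dots> \<le> s * \<bar>b\<bar>" using assms(2) by (intro mult_right_mono) auto
    finally show ?thesis using assms(1) by simp
  qed
  then have "p \<le> measure stdn {b. t < \<bar>b\<bar>}"
    unfolding p_def by (intro stdn.finite_measure_mono) auto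
  also have "\<dots> \<le> 2 * exp (- t\<^sup>2 / 2) / t" using assms(6) by (intro stdn_tail_le) simp
  finally show "p \<le> 2 * exp (- t\<^sup>2 / 2) / t" .
  have "p \<le> measure stdn {b. y \<le> \<bar>\<sigma> * b\<bar>}"
    unfolding p_def using dev by (intro stdn.finite_measure_mono) auto
  also have "\<dots> \<le> \<sigma>\<^sup>2 / y\<^sup>2" using y0 by (intro stdn_chebyshev) simp
  also have "\<dots> \<le> s\<^sup>2 / y\<^sup>2"
    using assms(1,2) by (intro divide_right_mono) (simp_all add: abs_le_square_iff[symmetric])
  finally have p: "p \<le> (s / y)\<^sup>2" by (simp add: power_divide)
  have r: "s / y \<le> 1 / t" "0 \<le> s / y" using y y0 assms(1,6) by (auto simp: field_simps)
  have r1: "s / y \<le> 1" using r(1) assms(6) by (simp add: order.trans[OF r(1)])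
  have "\<gamma> * t * (s / y) \<le> \<gamma> * t * (1 / t)" using r assms by (intro mult_left_mono) auto
  also have "\<dots> = \<gamma>" using assms(6) by simp
  finally have "\<gamma> * t * (s / y) \<le> \<gamma>" .
  \<comment> \<open>Splits |\<omega>| = \<gamma> t + y; each of the three terms is at most 1, since
    s / y \<le> 1 / t and both \<gamma> and s are at most 1.\<close>
  moreover have "(1 + \<bar>\<omega>\<bar>) * (s / y) = s / y + \<gamma> * t * (s / y) + y * (s / y)"
  proof -
    have w: "\<bar>\<omega>\<bar> = \<gamma> * t + y" by (simp add: y_def)
    show ?thesis unfolding w by (simp add: algebra_simps add_divide_distrib)
  qed
  moreover have "y * (s / y) = s" using y0 by simp
  ultimately have "(1 + \<bar>\<omega>\<bar>) * (s / y) \<le> s / y + \<gamma> + s" by linarith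
  then have w: "(1 + \<bar>\<omega>\<bar>) * (s / y) \<le> 3" using r1 assms by simp
  have "(1 + \<bar>\<omega>\<bar>) * p \<le> (1 + \<bar>\<omega>\<bar>) * (s / y)\<^sup>2" using p by (intro mult_left_mono) auto
  also have "\<dots> = ((1 + \<bar>\<omega>\<bar>) * (s / y)) * (s / y)" by (simp add: power2_eq_square)
  also have "\<dots> \<le> 3 * (1 / t)" using w r by (intro mult_mono) auto
  finally show "(1 + \<bar>\<omega>\<bar>) * p \<le> 3 / t" by simp
  have "(1 + \<bar>\<omega>\<bar>)\<^sup>2 * p \<le> (1 + \<bar>\<omega>\<bar>)\<^sup>2 * (s / y)\<^sup>2" using p by (intro mult_left_mono) auto
  also have "\<dots> = ((1 + \<bar>\<omega>\<bar>) * (s / y))\<^sup>2" by (simp only: power_mult_distrib)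
  also have "\<dots> \<le> 3\<^sup>2" using w r by (intro power_mono mult_nonneg_nonneg) auto
  finally show "(1 + \<bar>\<omega>\<bar>)\<^sup>2 * p \<le> 9" by simp
qed

text \<open>The error is zero unless |x| > m, and then |x| \<le> x^2 / m. A second moment thus
  bounds the bias caused by truncation.\<close>

lemma abs_clip_minus_le:
  fixes x m :: real
  assumes "0 < m"
  shows "\<bar>sgn x * min \<bar>x\<bar> m - x\<bar> \<le> x\<^sup>2 / m"
proof (cases "\<bar>x\<bar> \<le> m")
  case True
  then show ?thesis using assms by (simp add: min_def mult_sgn_abs)
next
  case False
  then have "\<bar>sgn x * min \<bar>x\<bar> m - x\<bar> \<le> \<bar>x\<bar>"
    using assms by (auto simp: min_def sgn_if)
  also have "\<dots> = \<bar>x\<bar> * m / m" using assms by simp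
  also have "\<dots> \<le> \<bar>x\<bar> * \<bar>x\<bar> / m"
    using False assms by (intro divide_right_mono mult_left_mono) auto
  finally show ?thesis by (simp add: power2_eq_square)
qed

lemma abs_clip_le:
  fixes x m :: real
  assumes "0 \<le> m"
  shows "\<bar>sgn x * min \<bar>x\<bar> m\<bar> \<le> m" "\<bar>sgn x * min \<bar>x\<bar> m\<bar> \<le> \<bar>x\<bar>"
  using assms by (auto simp: min_def sgn_if)


text \<open>\<open>T_rand\<close> as a function of \<open>U\<close> and \<open>V\<close>, for any polynomial \<open>S\<close> and truncation level \<open>m\<close>.\<close>

definition T_uv :: "real \<Rightarrow> real \<Rightarrow> real poly \<Rightarrow> real \<Rightarrow> real \<Rightarrow> real \<Rightarrow> real" where
  "T_uv \<beta> \<rho> S m u v =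
    (if v < - \<rho> then - \<beta> * u
     else if \<bar>v\<bar> \<le> \<rho> then sgn (poly S u) * min \<bar>poly S u\<bar> m
     else (1 - \<beta>) * u)"

lemma borel_measurable_poly [measurable (raw)]:
  fixes p :: "real poly"
  assumes "f \<in> borel_measurable M"
  shows "(\<lambda>x. poly p (f x)) \<in> borel_measurable M"
  using measurable_compose[OF assms borel_measurable_continuous_onI[OF continuous_on_poly[OF continuous_on_id]]]
  by simp

lemma integrable_clip_stdn:
  assumes "0 \<le> m"
  shows "integrable stdn (\<lambda>a. sgn (poly S (\<omega> + \<sigma> * a)) * min \<bar>poly S (\<omega> + \<sigma> * a)\<bar> m)"
proof (rule stdn.integrable_const_bound[where B=m])
  show "AE a in stdn. norm (sgn (poly S (\<omega> + \<sigma> * a)) * min \<bar>poly S (\<omega> + \<sigma> * a)\<bar> m) \<le> m"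
    using abs_clip_le(1)[OF assms] by (intro AE_I2) (simp only: real_norm_def)
qed measurable

lemma integrable_clip_sq_stdn:
  assumes "0 \<le> m"
  shows "integrable stdn (\<lambda>a. (sgn (poly S (\<omega> + \<sigma> * a)) * min \<bar>poly S (\<omega> + \<sigma> * a)\<bar> m - c)\<^sup>2)"
proof (rule stdn.integrable_const_bound[where B="(m + \<bar>c\<bar>)\<^sup>2"])
  have "\<bar>sgn x * min \<bar>x\<bar> m - c\<bar> \<le> m + \<bar>c\<bar>" for x
    using abs_clip_le(1)[OF assms, of x] by linarith
  then have "(sgn x * min \<bar>x\<bar> m - c)\<^sup>2 \<le> (m + \<bar>c\<bar>)\<^sup>2" for x
    using assms by (intro abs_le_square_iff[THEN iffD1]) auto
  then show "AE a in stdn. norm ((sgn (poly S (\<omega> + \<sigma> * a)) * min \<bar>poly S (\<omega> + \<sigma> * a)\<bar> m - c)\<^sup>2) \<le> (m + \<bar>c\<bar>)\<^sup>2"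
    by (intro AE_I2) simp
qed measurable

lemma integral_affine_stdn: "(\<integral>a. c * (\<omega> + \<sigma> * a) \<partial>stdn) = c * \<omega>"
  using integral_hermite_poly[of \<sigma> 1 \<omega>] by simp

lemma integral_affine_sq_stdn: "(\<integral>a. (c + \<sigma> * a)\<^sup>2 \<partial>stdn) = c\<^sup>2 + \<sigma>\<^sup>2"
  using stein_stdn_affine[of c \<sigma> "[:0, 1:]"] integral_hermite_poly[of \<sigma> 1 c] stdn.prob_space
  by (simp add: power2_eq_square pderiv_pCons)

text \<open>The polynomial enters only through \<open>near\<close>, for \<omega> within (\<gamma> +
  s) t; beyond, its truncation at m and the small probability of the middle region suffice. The
  identity m = exp (t^2 / 2) ties the truncation to the Gaussian tail. In the bounds, 16 = 8 + 8
  stems from the two linear branches, 5 = 2 + 3 from the far case of the middle one, and 38 = 2 (9 +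
  1) + 18 from all three.\<close>

lemma T_uv_bounds:
  fixes \<omega> \<sigma> \<beta> \<gamma> t m
  assumes \<beta>: "0 \<le> \<beta>" "\<beta> \<le> 1" and s: "0 < s" "\<bar>\<sigma>\<bar> \<le> s" "s \<le> 1"
    and \<gamma>: "0 \<le> \<gamma>" "\<gamma> \<le> 1" and t: "1 \<le> t" "1 \<le> \<gamma> * t" and m: "m = exp (t\<^sup>2 / 2)"
    and near: "\<bar>\<omega>\<bar> \<le> (\<gamma> + s) * t \<Longrightarrow> (\<integral>a. (poly S (\<omega> + \<sigma> * a))\<^sup>2 \<partial>stdn) \<le> M"
      "\<bar>\<omega>\<bar> \<le> (\<gamma> + s) * t \<Longrightarrow> \<bar>(\<integral>a. poly S (\<omega> + \<sigma> * a) \<partial>stdn) - G \<omega> \<beta>\<bar> \<le> R"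
    and MR: "0 \<le> M" "0 \<le> R"
  shows "integrable (stdn \<Otimes>\<^sub>M stdn) (\<lambda>(a, b). T_uv \<beta> (\<gamma> * t) S m (\<omega> + \<sigma> * a) (\<omega> + \<sigma> * b))" (is ?int)
    and "integrable (stdn \<Otimes>\<^sub>M stdn) (\<lambda>(a, b). (T_uv \<beta> (\<gamma> * t) S m (\<omega> + \<sigma> * a) (\<omega> + \<sigma> * b) - G \<omega> \<beta>)\<^sup>2)" (is ?int2)
    and "\<bar>(\<integral>(a, b). T_uv \<beta> (\<gamma> * t) S m (\<omega> + \<sigma> * a) (\<omega> + \<sigma> * b) \<partial>(stdn \<Otimes>\<^sub>M stdn)) - G \<omega> \<beta>\<bar> \<le>
      16 / (\<gamma> * t) + 5 / t + M / m + R" (is ?bias)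
    and "(\<integral>(a, b). (T_uv \<beta> (\<gamma> * t) S m (\<omega> + \<sigma> * a) (\<omega> + \<sigma> * b) - G \<omega> \<beta>)\<^sup>2 \<partial>(stdn \<Otimes>\<^sub>M stdn)) \<le>
      38 + 4 * m / t + 2 * M + 2 * (1 + (\<gamma> + s) * t)\<^sup>2" (is ?var)
proof -
  let ?S = "\<lambda>a. poly S (\<omega> + \<sigma> * a)"
  let ?C = "\<lambda>a. sgn (?S a) * min \<bar>?S a\<bar> m"
  \<comment> \<open>\<open>?B3\<close> is the right region, written as a left one for - \<omega> and
    - \<sigma> so that \<open>G_mult_left_tail_le\<close> applies to it as well.\<close>
  let ?B1 = "{b. \<omega> + \<sigma> * b < - (\<gamma> * t)}" and ?B2 = "{b. \<bar>\<omega> + \<sigma> * b\<bar> \<le> \<gamma> * t}"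
    and ?B3 = "{b. - \<omega> + (- \<sigma>) * b < - (\<gamma> * t)}"
  define p1 p2 p3 where p: "p1 = measure stdn ?B1" "p2 = measure stdn ?B2" "p3 = measure stdn ?B3"
  define g where "g = G \<omega> \<beta>"
  have m0: "0 < m" by (simp add: m)
  have B: "?B1 \<in> sets borel" "?B2 \<in> sets borel" "?B3 \<in> sets borel" by measurable
  have \<gamma>t: "0 \<le> \<gamma> * t" using t(2) by simp
  have disj: "?B1 \<inter> ?B2 = {}" "?B3 = - (?B1 \<union> ?B2)"
    using \<gamma>t by (auto simp: abs_le_iff not_less not_le)
  have p01: "0 \<le> p1" "p1 \<le> 1" "0 \<le> p2" "p2 \<le> 1" "0 \<le> p3" "p3 \<le> 1" by (simp_all add: p)
  have sum_p: "p1 + p2 + p3 = 1"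
  proof -
    have "p1 + p2 = measure stdn (?B1 \<union> ?B2)"
      unfolding p using B disj by (intro stdn.finite_measure_Union[symmetric]) auto
    moreover have "p3 = 1 - measure stdn (?B1 \<union> ?B2)"
      unfolding p disj(2) using stdn.prob_compl[of "?B1 \<union> ?B2"] B by (simp add: Compl_eq_Diff_UNIV)
    ultimately show ?thesis by simp
  qed
  have \<sigma>2: "\<sigma>\<^sup>2 \<le> 1" using s by (simp add: abs_square_le_1)
  have affine: "integrable stdn (\<lambda>a. c * (\<omega> + \<sigma> * a))" for c
    using integrable_poly_stdn[of "[:0, c:]" \<omega> \<sigma>] by (simp add: mult.commute)
  have affine2: "integrable stdn (\<lambda>a. (c * (\<omega> + \<sigma> * a) - g)\<^sup>2)" for c
    using integrable_poly_stdn[of "[:-g, c:]\<^sup>2" \<omega> \<sigma>] by (simp add: mult.commute)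
  have m0': "0 \<le> m" using m0 by simp
  note 1 = stdn2_integral_cases[OF affine[of "- \<beta>"] integrable_clip_stdn[OF m0', of S \<omega> \<sigma>] affine[of "1 - \<beta>"] B disj,
      where h="\<lambda>a b. T_uv \<beta> (\<gamma> * t) S m (\<omega> + \<sigma> * a) (\<omega> + \<sigma> * b)"]
  note 2 = stdn2_integral_cases[OF affine2[of "- \<beta>"] integrable_clip_sq_stdn[OF m0', of S \<omega> \<sigma> g] affine2[of "1 - \<beta>"] B disj,
      where h="\<lambda>a b. (T_uv \<beta> (\<gamma> * t) S m (\<omega> + \<sigma> * a) (\<omega> + \<sigma> * b) - g)\<^sup>2"]
  show ?int by (intro 1(1)) (auto simp: T_uv_def)
  show ?int2 unfolding g_def[symmetric] by (intro 2(1)) (auto simp: T_uv_def)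
  have I1: "(\<integral>(a, b). T_uv \<beta> (\<gamma> * t) S m (\<omega> + \<sigma> * a) (\<omega> + \<sigma> * b) \<partial>(stdn \<Otimes>\<^sub>M stdn)) =
      - \<beta> * \<omega> * p1 + (\<integral>a. ?C a \<partial>stdn) * p2 + (1 - \<beta>) * \<omega> * p3"
    unfolding p using m0 by (subst 1(2)) (auto simp: T_uv_def integral_affine_stdn)
  have sq: "(\<integral>a. (c * (\<omega> + \<sigma> * a) - g)\<^sup>2 \<partial>stdn) = (c * \<omega> - g)\<^sup>2 + c\<^sup>2 * \<sigma>\<^sup>2" for c
    using integral_affine_sq_stdn[of "c * \<omega> - g" "c * \<sigma>"] by (simp add: algebra_simps power_mult_distrib)
  have I2: "(\<integral>(a, b). (T_uv \<beta> (\<gamma> * t) S m (\<omega> + \<sigma> * a) (\<omega> + \<sigma> * b) - g)\<^sup>2 \<partial>(stdn \<Otimes>\<^sub>M stdn)) =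
      ((- \<beta> * \<omega> - g)\<^sup>2 + (- \<beta>)\<^sup>2 * \<sigma>\<^sup>2) * p1 + (\<integral>a. (?C a - g)\<^sup>2 \<partial>stdn) * p2 +
      (((1 - \<beta>) * \<omega> - g)\<^sup>2 + (1 - \<beta>)\<^sup>2 * \<sigma>\<^sup>2) * p3"
    unfolding p sq[symmetric] using m0 by (subst 2(2)) (auto simp: T_uv_def)
  have e1: "- \<beta> * \<omega> - g = - G \<omega> 0" using G_eq[of \<omega> \<beta>] by (simp add: g_def)
  have e3: "(1 - \<beta>) * \<omega> - g = - G (- \<omega>) 0"
    using G_eq[of \<omega> \<beta>] G_reflect[of \<omega>] by (simp add: g_def algebra_simps)
  have tail1: "G \<omega> 0 * p1 \<le> 8 / (\<gamma> * t)" "(G \<omega> 0)\<^sup>2 * p1 \<le> 9"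
    unfolding p by (intro G_mult_left_tail_le t \<sigma>2)+
  have tail3: "G (- \<omega>) 0 * p3 \<le> 8 / (\<gamma> * t)" "(G (- \<omega>) 0)\<^sup>2 * p3 \<le> 9"
    unfolding p using \<sigma>2 by (intro G_mult_left_tail_le t; simp)+
  have iS: "integrable stdn ?S" "integrable stdn (\<lambda>a. (?S a)\<^sup>2)"
    using integrable_poly_stdn[of S \<omega> \<sigma>] integrable_poly_stdn[of "S\<^sup>2" \<omega> \<sigma>] by simp_all
  have iC: "integrable stdn ?C" "integrable stdn (\<lambda>a. (?C a)\<^sup>2)"
    using integrable_clip_stdn[of m S \<omega> \<sigma>] integrable_clip_sq_stdn[of m S \<omega> \<sigma> 0] m0 by auto
  have g_le: "\<bar>g\<bar> \<le> 1 + \<bar>\<omega>\<bar>" unfolding g_def using \<beta> by (rule abs_G_le)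
  have mid: "\<bar>(\<integral>a. ?C a \<partial>stdn) - g\<bar> * p2 \<le> 5 / t + M / m + R \<and>
    (\<integral>a. (?C a - g)\<^sup>2 \<partial>stdn) * p2 \<le> 18 + 4 * m / t + 2 * M + 2 * (1 + (\<gamma> + s) * t)\<^sup>2"
  proof -
    have "(\<integral>a. (?C a - g)\<^sup>2 \<partial>stdn) \<le> (\<integral>a. 2 * (?C a)\<^sup>2 + 2 * g\<^sup>2 \<partial>stdn)"
    proof (rule integral_mono)
      show "integrable stdn (\<lambda>a. (?C a - g)\<^sup>2)" using m0 by (intro integrable_clip_sq_stdn) simp
      show "integrable stdn (\<lambda>a. 2 * (?C a)\<^sup>2 + 2 * g\<^sup>2)" using iC by auto
      fix a
      have "0 \<le> (?C a + g)\<^sup>2" by simp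
      then show "(?C a - g)\<^sup>2 \<le> 2 * (?C a)\<^sup>2 + 2 * g\<^sup>2" by (simp only: power2_sum power2_diff)
    qed
    also have "\<dots> = 2 * (\<integral>a. (?C a)\<^sup>2 \<partial>stdn) + 2 * g\<^sup>2"
      using iC stdn.prob_space by (simp add: Bochner_Integration.integral_add)
    finally have V: "(\<integral>a. (?C a - g)\<^sup>2 \<partial>stdn) \<le> 2 * (\<integral>a. (?C a)\<^sup>2 \<partial>stdn) + 2 * g\<^sup>2" .
    \<comment> \<open>In the near case p2 \<le> 1 is enough; the terms that belong to the far case
      are added as nonnegative slack.\<close>
    have arith1: "x \<le> a + b + c" if "x \<le> (b + c) * 1" "0 \<le> a" for x a b c :: real
      using that by simp
    have arith2: "x \<le> 18 + k + 2 * M + 2 * c"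
      if "y \<le> M" "d \<le> c" "x \<le> z * 1" "0 \<le> k" "z \<le> 2 * y + 2 * d" for x y z c d k :: real
      using that by simp
    show ?thesis
    proof (cases "\<bar>\<omega>\<bar> \<le> (\<gamma> + s) * t")
      case True
      have "\<bar>(\<integral>a. ?C a \<partial>stdn) - (\<integral>a. ?S a \<partial>stdn)\<bar> = \<bar>\<integral>a. ?C a - ?S a \<partial>stdn\<bar>"
        by (subst Bochner_Integration.integral_diff[OF iC(1) iS(1)]) simp
      also have "\<dots> \<le> (\<integral>a. (?S a)\<^sup>2 / m \<partial>stdn)"
        using abs_clip_minus_le[OF m0] iS iC
        by (intro integral_abs_bound[THEN order.trans] integral_mono integrable_abs
            Bochner_Integration.integrable_diff integrable_divide) auto
      also have "\<dots> \<le> M / m" using near(1)[OF True] m0 by (simp add: divide_right_mono)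
      finally have *: "\<bar>(\<integral>a. ?C a \<partial>stdn) - g\<bar> \<le> M / m + R"
        using near(2)[OF True] by (simp add: g_def)
      have "\<bar>(\<integral>a. ?C a \<partial>stdn) - g\<bar> * p2 \<le> (M / m + R) * 1"
        using * p01 by (intro mult_mono) auto
      moreover have "0 \<le> 5 / t" using t by simp
      moreover have "(\<integral>a. (?C a)\<^sup>2 \<partial>stdn) \<le> (\<integral>a. (?S a)\<^sup>2 \<partial>stdn)"
        using iC iS abs_clip_le(2)[of m] m0 by (intro integral_mono) (auto simp: abs_le_square_iff[symmetric])
      with near(1)[OF True] have "(\<integral>a. (?C a)\<^sup>2 \<partial>stdn) \<le> M" by simp
      moreover have "g\<^sup>2 \<le> (1 + (\<gamma> + s) * t)\<^sup>2"
        using g_le True by (intro abs_le_square_iff[THEN iffD1]) auto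
      moreover have "(\<integral>a. (?C a - g)\<^sup>2 \<partial>stdn) * p2 \<le> (\<integral>a. (?C a - g)\<^sup>2 \<partial>stdn) * 1"
        using p01 by (intro mult_left_mono integral_nonneg_AE) auto
      moreover have "0 \<le> 4 * m / t" using m0 t by simp
      ultimately show ?thesis using V by (intro conjI arith1 arith2)
    next
      case False
      then have far: "p2 \<le> 2 * exp (- t\<^sup>2 / 2) / t" "(1 + \<bar>\<omega>\<bar>) * p2 \<le> 3 / t" "(1 + \<bar>\<omega>\<bar>)\<^sup>2 * p2 \<le> 9"
        using middle_prob_le[OF s \<gamma> t(1)] unfolding p by auto
      \<comment> \<open>The truncation level and the exponential in the tail cancel exactly, which
        leaves 2 / t.\<close>
      have mp: "m * p2 \<le> 2 / t"
      proof -
        have "m * p2 \<le> m * (2 * exp (- t\<^sup>2 / 2) / t)" using far(1) m0 by (intro mult_left_mono) auto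
        also have "\<dots> = 2 / t" by (simp add: m exp_minus)
        finally show ?thesis .
      qed
      have "\<bar>\<integral>a. ?C a \<partial>stdn\<bar> \<le> (\<integral>a. m \<partial>stdn)"
        using abs_clip_le(1)[of m] m0 iC
        by (intro integral_abs_bound[THEN order.trans] integral_mono integrable_abs) auto
      then have C: "\<bar>\<integral>a. ?C a \<partial>stdn\<bar> \<le> m" using stdn.prob_space by simp
      have "(\<integral>a. (?C a)\<^sup>2 \<partial>stdn) \<le> (\<integral>a. m\<^sup>2 \<partial>stdn)"
        using abs_clip_le(1)[of m] m0 iC
        by (intro integral_mono) (auto simp: abs_le_square_iff[symmetric])
      then have C2: "(\<integral>a. (?C a)\<^sup>2 \<partial>stdn) \<le> m\<^sup>2" using stdn.prob_space by simp
      have "\<bar>(\<integral>a. ?C a \<partial>stdn) - g\<bar> * p2 \<le> (m + (1 + \<bar>\<omega>\<bar>)) * p2"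
        using C g_le p01 by (intro mult_right_mono) auto
      also have "\<dots> \<le> 2 / t + 3 / t" using mp far(2) by (simp add: distrib_right)
      finally have 1: "\<bar>(\<integral>a. ?C a \<partial>stdn) - g\<bar> * p2 \<le> 5 / t" by simp
      have "g\<^sup>2 \<le> (1 + \<bar>\<omega>\<bar>)\<^sup>2" using g_le by (intro abs_le_square_iff[THEN iffD1]) auto
      then have "(\<integral>a. (?C a - g)\<^sup>2 \<partial>stdn) * p2 \<le> (2 * m\<^sup>2 + 2 * (1 + \<bar>\<omega>\<bar>)\<^sup>2) * p2"
        using V C2 p01 by (intro mult_right_mono) auto
      \<comment> \<open>One factor m of the squared truncation level is absorbed by the probability;
        the other remains and gives the leading term of the mean square error.\<close>
      also have "\<dots> = 2 * m * (m * p2) + 2 * ((1 + \<bar>\<omega>\<bar>)\<^sup>2 * p2)"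
        by (simp add: algebra_simps power2_eq_square)
      also have "\<dots> \<le> 2 * m * (2 / t) + 2 * 9"
        using mp far(3) m0 by (intro add_mono mult_left_mono) auto
      finally have 2: "(\<integral>a. (?C a - g)\<^sup>2 \<partial>stdn) * p2 \<le> 18 + 4 * m / t" by simp
      have "0 \<le> M / m" "0 \<le> (1 + (\<gamma> + s) * t)\<^sup>2" using MR m0 by auto
      with 1 2 MR show ?thesis by (auto intro: order.trans add_increasing2)
    qed
  qed
  have diff: "(\<integral>(a, b). T_uv \<beta> (\<gamma> * t) S m (\<omega> + \<sigma> * a) (\<omega> + \<sigma> * b) \<partial>(stdn \<Otimes>\<^sub>M stdn)) - g =
     (- \<beta> * \<omega> - g) * p1 + ((\<integral>a. ?C a \<partial>stdn) - g) * p2 + ((1 - \<beta>) * \<omega> - g) * p3"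
  proof -
    \<comment> \<open>Spreads the target over the three regions, so that each branch is compared
      with it separately.\<close>
    have "g = g * (p1 + p2 + p3)" by (simp add: sum_p)
    then show ?thesis unfolding I1 by (simp add: algebra_simps)
  qed
  have bias: "\<bar>(\<integral>(a, b). T_uv \<beta> (\<gamma> * t) S m (\<omega> + \<sigma> * a) (\<omega> + \<sigma> * b) \<partial>(stdn \<Otimes>\<^sub>M stdn)) - g\<bar> \<le>
     G \<omega> 0 * p1 + \<bar>(\<integral>a. ?C a \<partial>stdn) - g\<bar> * p2 + G (- \<omega>) 0 * p3"
  proof -
    have tri: "\<bar>- x + y - z\<bar> \<le> x + \<bar>y\<bar> + z" if "0 \<le> x" "0 \<le> z" for x y z :: real
      using that by linarith
    show ?thesis unfolding diff e1 e3
      using tri[of "G \<omega> 0 * p1" "G (- \<omega>) 0 * p3" "((\<integral>a. ?C a \<partial>stdn) - g) * p2"]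
        G_nonneg[of \<omega>] G_nonneg[of "- \<omega>"] p01 by (simp add: abs_mult)
  qed
  have arith: "x \<le> 16 / y + 5 / t + M / m + R"
    if "x \<le> a + b + c" "a \<le> 8 / y" "c \<le> 8 / y" "b \<le> 5 / t + M / m + R" for x y a b c :: real
  proof -
    have "16 / y = 8 / y + 8 / y" by simp
    then show ?thesis using that by linarith
  qed
  show ?bias
    unfolding g_def[symmetric] by (rule arith[OF bias tail1(1) tail3(1) conjunct1[OF mid]])
  have small: "c\<^sup>2 * \<sigma>\<^sup>2 * q \<le> 1" if "\<bar>c\<bar> \<le> 1" "0 \<le> q" "q \<le> 1" for c q
    using that \<sigma>2 by (intro mult_le_one) (auto simp: abs_square_le_1)
  have small1: "(- \<beta>)\<^sup>2 * \<sigma>\<^sup>2 * p1 \<le> 1" and small3: "(1 - \<beta>)\<^sup>2 * \<sigma>\<^sup>2 * p3 \<le> 1"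
    using \<beta> p01 by (intro small; simp)+
  have arith': "((- a1)\<^sup>2 + b1) * p1 + x + ((- a3)\<^sup>2 + b3) * p3 \<le> 38 + 4 * m / t + 2 * M + 2 * k"
    if "b1 * p1 \<le> 1" "b3 * p3 \<le> 1" "a1\<^sup>2 * p1 \<le> 9" "a3\<^sup>2 * p3 \<le> 9" "x \<le> 18 + 4 * m / t + 2 * M + 2 * k"
    for a1 b1 a3 b3 x k :: real
    using that unfolding distrib_right power2_minus by linarith
  show ?var
    unfolding g_def[symmetric] I2 e1 e3
    by (rule arith'[OF small1 small3 tail1(2) tail3(2) conjunct2[OF mid]])
qed

section \<open>The original coordinates\<close>

lemma stdn_square_integral_le:
  fixes f :: "real \<Rightarrow> real"
  assumes "integrable stdn f" "integrable stdn (\<lambda>x. (f x)\<^sup>2)"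
  shows "(\<integral>x. f x \<partial>stdn)\<^sup>2 \<le> (\<integral>x. (f x)\<^sup>2 \<partial>stdn)"
  using stdn.variance_positive[of f] stdn.variance_eq[OF assms] by simp

text \<open>Averaging over the auxiliary variable is a conditional expectation given the data: it
  keeps the mean, and by Jensen's inequality it does not increase the mean square distance from a
  constant. Fibres are integrable only almost everywhere, hence the AE form of the
  inequality.\<close>

lemma stdn2_conditional_expectation:
  fixes H :: "real \<times> real \<Rightarrow> real" and g :: real
  assumes H: "integrable (stdn \<Otimes>\<^sub>M stdn) H"
    and H2: "integrable (stdn \<Otimes>\<^sub>M stdn) (\<lambda>x. (H x - g)\<^sup>2)"
    and h: "\<And>w. h w = (\<integral>z. H (w, z) \<partial>stdn)"
  shows "integrable stdn h" "(\<integral>w. h w \<partial>stdn) = (\<integral>x. H x \<partial>(stdn \<Otimes>\<^sub>M stdn))"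
    "integrable stdn (\<lambda>w. (h w - g)\<^sup>2)"
    "(\<integral>w. (h w - g)\<^sup>2 \<partial>stdn) \<le> (\<integral>x. (H x - g)\<^sup>2 \<partial>(stdn \<Otimes>\<^sub>M stdn))"
proof -
  have h_def: "h = (\<lambda>w. \<integral>z. H (w, z) \<partial>stdn)" using h by blast
  show h: "integrable stdn h" unfolding h_def by (rule stdn2.integrable_fst'[OF H])
  show "(\<integral>w. h w \<partial>stdn) = (\<integral>x. H x \<partial>(stdn \<Otimes>\<^sub>M stdn))"
    unfolding h_def by (rule stdn2.integral_fst'[OF H])
  have ae: "AE w in stdn. (h w - g)\<^sup>2 \<le> (\<integral>z. (H (w, z) - g)\<^sup>2 \<partial>stdn)"
    using stdn2.AE_integrable_fst'[OF H] stdn2.AE_integrable_fst'[OF H2]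
  proof eventually_elim
    case (elim w)
    have "h w - g = (\<integral>z. H (w, z) - g \<partial>stdn)"
      using elim(1) by (simp add: h_def Bochner_Integration.integral_diff)
    then show ?case
      using stdn_square_integral_le[of "\<lambda>z. H (w, z) - g"] elim by simp
  qed
  note i = stdn2.integrable_fst'[OF H2]
  show h2: "integrable stdn (\<lambda>w. (h w - g)\<^sup>2)"
  proof (rule Bochner_Integration.integrable_bound[OF i])
    show "AE w in stdn. norm ((h w - g)\<^sup>2) \<le> norm (\<integral>z. (H (w, z) - g)\<^sup>2 \<partial>stdn)"
      using ae by eventually_elim simp
  qed (use h in measurable)
  show "(\<integral>w. (h w - g)\<^sup>2 \<partial>stdn) \<le> (\<integral>x. (H x - g)\<^sup>2 \<partial>(stdn \<Otimes>\<^sub>M stdn))"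
    unfolding stdn2.integral_fst'[OF H2, symmetric] by (rule integral_mono_AE[OF h2 i ae])
qed

lemma stdn2_rotate:
  fixes F :: "real \<times> real \<Rightarrow> real"
  assumes F: "integrable (stdn \<Otimes>\<^sub>M stdn) F"
  shows "integrable (stdn \<Otimes>\<^sub>M stdn) (\<lambda>(x, z). F ((x + z) / sqrt 2, (x - z) / sqrt 2))"
    and "(\<integral>(x, z). F ((x + z) / sqrt 2, (x - z) / sqrt 2) \<partial>(stdn \<Otimes>\<^sub>M stdn)) =
      (\<integral>x. F x \<partial>(stdn \<Otimes>\<^sub>M stdn))"
proof -
  let ?r = "\<lambda>(x::real, z::real). ((x + z) / sqrt 2, (x - z) / sqrt 2)"
  have [measurable]: "?r \<in> stdn \<Otimes>\<^sub>M stdn \<rightarrow>\<^sub>M stdn \<Otimes>\<^sub>M stdn" by measurable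
  have eq: "(\<lambda>(x, z). F ((x + z) / sqrt 2, (x - z) / sqrt 2)) = (\<lambda>x. F (?r x))"
    by (auto simp: fun_eq_iff)
  have m: "F \<in> borel_measurable (stdn \<Otimes>\<^sub>M stdn)" using F by auto
  show "integrable (stdn \<Otimes>\<^sub>M stdn) (\<lambda>(x, z). F ((x + z) / sqrt 2, (x - z) / sqrt 2))"
    unfolding eq using integrable_distr_eq[OF _ m, of ?r "stdn \<Otimes>\<^sub>M stdn"] F
    by (simp add: distr_stdn_rotate)
  show "(\<integral>(x, z). F ((x + z) / sqrt 2, (x - z) / sqrt 2) \<partial>(stdn \<Otimes>\<^sub>M stdn)) =
      (\<integral>x. F x \<partial>(stdn \<Otimes>\<^sub>M stdn))"
    unfolding eq using integral_distr[OF _ m, of ?r "stdn \<Otimes>\<^sub>M stdn"]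
    by (simp add: distr_stdn_rotate)
qed

text \<open>With X = \<theta> + sqrt \<nu>p w, the noise in U and V is d sqrt \<nu>p times w + z and
  w - z. Normalizing these by sqrt 2 produces the factor 2 in \<sigma> and in \<open>s_coef\<close>;
  the latter is |\<sigma>|, so the Hermite variances agree.\<close>

lemma T_rand_eq_T_uv:
  fixes \<theta> \<beta> \<nu>p \<nu>f \<gamma> w z :: real and \<tau> :: ennreal
  assumes "0 < \<nu>p"
  defines "\<omega> \<equiv> c_coef \<beta> \<nu>p \<nu>f \<tau> + d_coef \<nu>p \<nu>f \<tau> * \<theta>" and "\<sigma> \<equiv> d_coef \<nu>p \<nu>f \<tau> * sqrt (2 * \<nu>p)"
  shows "T_rand \<beta> \<nu>p \<nu>f \<gamma> n (\<theta> + sqrt \<nu>p * w) z \<tau> =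
    T_uv \<beta> (lam \<gamma> n) (G_series \<beta> (\<sigma>\<^sup>2) (K_trunc \<gamma> \<nu>p \<nu>f n - 1)) (real n)
      (\<omega> + \<sigma> * ((w + z) / sqrt 2)) (\<omega> + \<sigma> * ((w - z) / sqrt 2))"
proof -
  have "(s_coef \<nu>p \<nu>f \<tau>)\<^sup>2 = \<sigma>\<^sup>2"
    by (simp add: s_coef_def \<sigma>_def power_mult_distrib)
  moreover have "c_coef \<beta> \<nu>p \<nu>f \<tau> + d_coef \<nu>p \<nu>f \<tau> * (\<theta> + sqrt \<nu>p * w + sqrt \<nu>p * z) =
      \<omega> + \<sigma> * ((w + z) / sqrt 2)"
    by (simp add: \<omega>_def \<sigma>_def real_sqrt_mult field_simps)
  moreover have "c_coef \<beta> \<nu>p \<nu>f \<tau> + d_coef \<nu>p \<nu>f \<tau> * (\<theta> + sqrt \<nu>p * w - sqrt \<nu>p * z) =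
      \<omega> + \<sigma> * ((w - z) / sqrt 2)"
    by (simp add: \<omega>_def \<sigma>_def real_sqrt_mult field_simps)
  ultimately show ?thesis
    unfolding T_rand_def T_uv_def S_tilde_def S_trunc_eq_poly Let_def by (simp only:)
qed

section \<open>Bounds uniform in the hyperparameter, and the exact risk of one coordinate\<close>

lemma alpha_bounds:
  assumes "0 < \<nu>p"
  shows "0 \<le> alpha \<nu>p \<tau>" "alpha \<nu>p \<tau> \<le> 1"
  using assms enn2real_nonneg[of \<tau>] add_nonneg_pos[of "enn2real \<tau>" \<nu>p]
  by (auto simp: alpha_def divide_le_eq_1)

text \<open>The extreme case is \<tau> = 0, where \<alpha> = 0. As the bound is free of \<tau>, one
  truncation length serves the whole range.\<close>

lemma abs_d_coef_mult_le:
  assumes "0 < \<nu>p" "0 < \<nu>f"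
  shows "\<bar>d_coef \<nu>p \<nu>f \<tau> * sqrt (2 * \<nu>p)\<bar> \<le> sqrt (2 * \<nu>p / \<nu>f)"
proof -
  let ?a = "alpha \<nu>p \<tau>"
  have a: "0 \<le> ?a" "?a \<le> 1" using alpha_bounds[OF assms(1)] by auto
  have "(1 - ?a) / sqrt (\<nu>f + ?a\<^sup>2 * \<nu>p) \<le> 1 / sqrt \<nu>f"
    using a assms by (intro frac_le) auto
  then have "(1 - ?a) / sqrt (\<nu>f + ?a\<^sup>2 * \<nu>p) * sqrt (2 * \<nu>p) \<le> 1 / sqrt \<nu>f * sqrt (2 * \<nu>p)"
    using assms by (intro mult_right_mono) auto
  moreover have "\<bar>d_coef \<nu>p \<nu>f \<tau>\<bar> = (1 - ?a) / sqrt (\<nu>f + ?a\<^sup>2 * \<nu>p)"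
    using a assms by (simp add: d_coef_def abs_of_nonneg)
  ultimately show ?thesis using assms by (simp add: abs_mult real_sqrt_divide)
qed

lemma normal_variance_eq_distr_stdn:
  assumes "0 < \<nu>"
  shows "density lborel (normal_density \<mu> (sqrt \<nu>)) = distr stdn borel (\<lambda>w. \<mu> + sqrt \<nu> * w)"
  using assms by (intro normal_eq_distr_stdn) simp

text \<open>G at \<beta> = 0 is an expected positive part, so smoothing it adds q w to the standard
  normal variable inside. The sum has deviation r = sqrt (q^2 + 1), which is then scaled out; the
  linear part is treated apart.\<close>

lemma integral_G_affine_stdn:
  "integrable stdn (\<lambda>w. G (p + q * w) \<beta>)"
  "(\<integral>w. G (p + q * w) \<beta> \<partial>stdn) = sqrt (q\<^sup>2 + 1) * G (p / sqrt (q\<^sup>2 + 1)) \<beta>"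
proof -
  define r where "r = sqrt (q\<^sup>2 + 1)"
  have r: "0 < r" by (simp add: r_def add_nonneg_pos)
  have aff: "integrable stdn (\<lambda>w. \<beta> * (p + q * w))" by simp
  have i: "integrable stdn (\<lambda>w. G (p + q * w) 0)"
  proof (rule Bochner_Integration.integrable_bound[of stdn "\<lambda>w. 1 + \<bar>p\<bar> + \<bar>q\<bar> * \<bar>w\<bar>"])
    show "AE w in stdn. norm (G (p + q * w) 0) \<le> norm (1 + \<bar>p\<bar> + \<bar>q\<bar> * \<bar>w\<bar>)"
    proof (intro AE_I2)
      fix w
      have "\<bar>p + q * w\<bar> \<le> \<bar>p\<bar> + \<bar>q\<bar> * \<bar>w\<bar>" by (metis abs_mult abs_triangle_ineq)
      then show "norm (G (p + q * w) 0) \<le> norm (1 + \<bar>p\<bar> + \<bar>q\<bar> * \<bar>w\<bar>)"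
        using abs_G_le[of 0 "p + q * w"] by simp
    qed
  qed simp_all
  show "integrable stdn (\<lambda>w. G (p + q * w) \<beta>)"
    using Bochner_Integration.integrable_diff[OF i aff] by (simp add: G_eq[of _ \<beta>])
  \<comment> \<open>The coefficient 1 is kept explicit to match
    \<open>distr_linear_comb_stdn\<close>.\<close>
  have m2: "integrable (stdn \<Otimes>\<^sub>M stdn) (\<lambda>(w, z). max (p + (q * w + 1 * z)) 0)"
  proof (rule stdn2.Fubini_integrable)
    show "integrable stdn (\<lambda>w. \<integral>z. norm (case (w, z) of (w, z) \<Rightarrow> max (p + (q * w + 1 * z)) 0) \<partial>stdn)"
      using i by (simp add: add.assoc[symmetric] integral_max_stdn)
    show "AE w in stdn. integrable stdn (\<lambda>z. case (w, z) of (w, z) \<Rightarrow> max (p + (q * w + 1 * z)) 0)"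
      by (auto intro!: AE_I2 integrable_max)
  qed measurable
  have "(\<integral>w. G (p + q * w) 0 \<partial>stdn) = (\<integral>w. \<integral>z. max (p + (q * w + 1 * z)) 0 \<partial>stdn \<partial>stdn)"
    by (simp add: integral_max_stdn add.assoc[symmetric])
  also have "\<dots> = (\<integral>x. max (p + (case x of (w, z) \<Rightarrow> q * w + 1 * z)) 0 \<partial>(stdn \<Otimes>\<^sub>M stdn))"
    using stdn2.integral_fst'[OF m2] by (simp add: case_prod_beta')
  also have "\<dots> = (\<integral>y. max (p + y) 0 \<partial>distr (stdn \<Otimes>\<^sub>M stdn) borel (\<lambda>(w, z). q * w + 1 * z))"
    by (subst integral_distr) auto
  also have "\<dots> = (\<integral>y. max (p + y) 0 \<partial>distr stdn borel (\<lambda>a. r * a))"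
    by (subst distr_linear_comb_stdn) (simp_all add: r_def)
  also have "\<dots> = (\<integral>a. max (p + r * a) 0 \<partial>stdn)"
    by (subst integral_distr) auto
  also have "\<dots> = (\<integral>a. r * max (p / r + a) 0 \<partial>stdn)"
    using r by (intro Bochner_Integration.integral_cong) (auto simp: max_def field_simps)
  also have "\<dots> = r * G (p / r) 0" by (simp add: integral_max_stdn)
  finally have "(\<integral>w. G (p + q * w) 0 \<partial>stdn) = r * G (p / r) 0" .
  then have "(\<integral>w. G (p + q * w) 0 - \<beta> * (p + q * w) \<partial>stdn) = r * G (p / r) 0 - \<beta> * p"
    using integral_affine_stdn[of \<beta> p q] by (subst Bochner_Integration.integral_diff[OF i aff]) simp
  then show "(\<integral>w. G (p + q * w) \<beta> \<partial>stdn) = sqrt (q\<^sup>2 + 1) * G (p / sqrt (q\<^sup>2 + 1)) \<beta>"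
    unfolding r_def[symmetric] using r by (simp add: G_eq[of _ \<beta>] algebra_simps)
qed

text \<open>The standardized prediction error is p + q w. Its intercept divided by sqrt (q^2 + 1) is
  exactly c + d \<theta>, which explains these two coefficients; the scale factor sqrt (q^2 + 1)
  gives the root in the weight.\<close>

lemma coordinate_risk:
  fixes \<theta> \<nu>p \<nu>f b h :: real and \<tau> :: ennreal
  assumes "0 < \<nu>p" "0 < \<nu>f"
  defines "\<alpha> \<equiv> alpha \<nu>p \<tau>" and "\<beta> \<equiv> crit_ratio b h"
  defines "N \<equiv> density lborel (normal_density \<theta> (sqrt \<nu>p))"
  defines "f \<equiv> \<lambda>x. loss_coord b h \<nu>f \<theta> (\<alpha> * x + sqrt (\<nu>f + \<alpha> * \<nu>p) * Phi_inv \<beta>)"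
  shows "integrable N f"
    "(\<integral>x. f x \<partial>N) = (b + h) * sqrt (\<nu>f + \<nu>p * \<alpha>\<^sup>2) *
      G (c_coef \<beta> \<nu>p \<nu>f \<tau> + d_coef \<nu>p \<nu>f \<tau> * \<theta>) \<beta>"
proof -
  define C where "C = sqrt (\<nu>f + \<alpha> * \<nu>p) * Phi_inv \<beta>"
  define p q where "p = (C - (1 - \<alpha>) * \<theta>) / sqrt \<nu>f" and "q = \<alpha> * sqrt \<nu>p / sqrt \<nu>f"
  have [measurable]: "f \<in> borel_measurable borel"
    unfolding f_def loss_coord_def by measurable
  have N: "N = distr stdn borel (\<lambda>w. \<theta> + sqrt \<nu>p * w)"
    unfolding N_def using assms(1) by (rule normal_variance_eq_distr_stdn)
  have f: "f (\<theta> + sqrt \<nu>p * w) = sqrt \<nu>f * (b + h) * G (p + q * w) \<beta>" for w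
    using assms(2) by (simp add: f_def loss_coord_def \<beta>_def p_def q_def C_def diff_divide_distrib
      add_divide_distrib algebra_simps)
  have "integrable stdn (\<lambda>w. f (\<theta> + sqrt \<nu>p * w))"
    unfolding f by (intro integrable_mult_right integral_G_affine_stdn)
  then show "integrable N f" unfolding N by (subst integrable_distr_eq) auto
  have a: "0 \<le> \<alpha>" "\<alpha> \<le> 1" using alpha_bounds[OF assms(1)] by (auto simp: \<alpha>_def)
  have S: "0 < \<nu>f + \<nu>p * \<alpha>\<^sup>2" using assms by (intro add_pos_nonneg) auto
  have r: "sqrt \<nu>f * sqrt (q\<^sup>2 + 1) = sqrt (\<nu>f + \<nu>p * \<alpha>\<^sup>2)"
  proof -
    have "\<nu>f * (q\<^sup>2 + 1) = \<nu>f + \<nu>p * \<alpha>\<^sup>2"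
      using assms by (simp add: q_def power_divide power_mult_distrib field_simps)
    then show ?thesis by (simp add: real_sqrt_mult[symmetric])
  qed
  have "p / sqrt (q\<^sup>2 + 1) = (C - (1 - \<alpha>) * \<theta>) / sqrt (\<nu>f + \<nu>p * \<alpha>\<^sup>2)"
    unfolding r[symmetric] p_def by simp
  also have "\<dots> = c_coef \<beta> \<nu>p \<nu>f \<tau> + d_coef \<nu>p \<nu>f \<tau> * \<theta>"
    by (simp add: c_coef_def d_coef_def \<alpha>_def[symmetric] C_def real_sqrt_divide diff_divide_distrib mult.commute)
       (simp add: algebra_simps diff_divide_distrib)
  finally have \<omega>: "p / sqrt (q\<^sup>2 + 1) = c_coef \<beta> \<nu>p \<nu>f \<tau> + d_coef \<nu>p \<nu>f \<tau> * \<theta>" .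
  have "(\<integral>x. f x \<partial>N) = (\<integral>w. f (\<theta> + sqrt \<nu>p * w) \<partial>stdn)"
    unfolding N by (subst integral_distr) auto
  also have "\<dots> = sqrt \<nu>f * (b + h) * (sqrt (q\<^sup>2 + 1) * G (p / sqrt (q\<^sup>2 + 1)) \<beta>)"
    unfolding f by (simp add: integral_G_affine_stdn)
  also have "\<dots> = (b + h) * (sqrt \<nu>f * sqrt (q\<^sup>2 + 1)) * G (p / sqrt (q\<^sup>2 + 1)) \<beta>"
    by simp
  finally show "(\<integral>x. f x \<partial>N) = (b + h) * sqrt (\<nu>f + \<nu>p * \<alpha>\<^sup>2) *
      G (c_coef \<beta> \<nu>p \<nu>f \<tau> + d_coef \<nu>p \<nu>f \<tau> * \<theta>) \<beta>"
    unfolding r \<omega> .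
qed

section \<open>Quantitative bounds\<close>

text \<open>This yields 1 / e \<le> 2 / 5, enough to get the exponent 9 / 10 < 1 in the second
  moment.\<close>

lemma exp_1_ge: "5 / 2 \<le> exp (1::real)"
  using exp_lower_Taylor_quadratic[of 1] by simp

text \<open>With q = s / sqrt 2 and r = 1 / sqrt (4e), the choice of \<gamma> gives \<gamma> + s < r
  + (sqrt 2 - 1) q \<le> sqrt 2 r, whose square is 1 / (2e).\<close>

lemma threshold_bounds:
  fixes \<gamma> \<nu>p \<nu>f :: real
  assumes "0 < \<nu>p" "0 < \<nu>f" "0 < \<gamma>" "\<gamma> < 1 / sqrt (4 * exp 1) - sqrt (\<nu>p / \<nu>f)"
  defines "s \<equiv> sqrt (2 * \<nu>p / \<nu>f)"
  shows "0 < s" "s\<^sup>2 \<le> 1 / (2 * exp 1)" "(\<gamma> + s)\<^sup>2 \<le> 1 / (2 * exp 1)" "\<gamma> + s \<le> 1"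
proof -
  define q where "q = sqrt (\<nu>p / \<nu>f)"
  define r where "r = 1 / sqrt (4 * exp (1::real))"
  have q: "0 < q" using assms by (simp add: q_def)
  have s: "s = sqrt 2 * q" by (simp add: s_def q_def real_sqrt_mult[symmetric])
  show "0 < s" using q by (simp add: s)
  have qr: "q < r" "\<gamma> < r - q" using assms(3,4) by (auto simp: q_def r_def)
  have r2: "(sqrt 2 * r)\<^sup>2 = 1 / (2 * exp 1)"
    by (simp add: r_def power_mult_distrib power_divide)
  have "s \<le> sqrt 2 * r" using qr(1) by (simp add: s)
  then show "s\<^sup>2 \<le> 1 / (2 * exp 1)"
    unfolding r2[symmetric] using \<open>0 < s\<close> by (intro power_mono) auto
  have "(sqrt 2 - 1) * q \<le> (sqrt 2 - 1) * r" using qr(1) by (intro mult_left_mono) auto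
  then have "\<gamma> + s \<le> sqrt 2 * r" using qr(2) by (simp add: s algebra_simps)
  then show le: "(\<gamma> + s)\<^sup>2 \<le> 1 / (2 * exp 1)"
    unfolding r2[symmetric] using \<open>0 < s\<close> assms(3) by (intro power_mono) auto
  also have "\<dots> \<le> 1\<^sup>2" using exp_1_ge by simp
  finally show "\<gamma> + s \<le> 1" by (rule power2_le_imp_le) simp
qed

text \<open>Here 3 + 3 ln n bounds the number of terms of the series, the leading 3 bounds exp 1,
  and 9 / 10 bounds 1 / e + 1 / 2.\<close>

definition second_moment_bound :: "nat \<Rightarrow> real" where
  "second_moment_bound n = 3 * (3 + 3 * ln (real n))\<^sup>2 * exp (9 / 10 * ln (real n))"

text \<open>The length K exceeds e^2 \<omega>^2, so that, apart from a factor \<omega>^2, the Taylor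
  remainder is below (J / e^2)^J / J! \<le> exp (- J) with J about K / 2. The constant \<gamma>0
  makes the resulting rate common to all coordinates.\<close>

lemma G_series_near_bounds:
  fixes \<gamma> \<gamma>0 \<nu>p \<nu>f \<sigma> \<omega> \<beta> :: real and n :: nat
  assumes pos: "0 < \<nu>p" "0 < \<nu>f" "0 < \<gamma>0" "\<gamma>0 \<le> \<gamma>"
    and \<gamma>: "\<gamma> < 1 / sqrt (4 * exp 1) - sqrt (\<nu>p / \<nu>f)"
    and \<beta>: "0 \<le> \<beta>" "\<beta> \<le> 1"
    and \<sigma>: "\<bar>\<sigma>\<bar> \<le> sqrt (2 * \<nu>p / \<nu>f)" and n: "1 \<le> n"
    and \<omega>: "\<bar>\<omega>\<bar> \<le> (\<gamma> + sqrt (2 * \<nu>p / \<nu>f)) * sqrt (2 * ln (real n))"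
  defines "S \<equiv> G_series \<beta> (\<sigma>\<^sup>2) (K_trunc \<gamma> \<nu>p \<nu>f n - 1)"
  shows "(\<integral>a. (poly S (\<omega> + \<sigma> * a))\<^sup>2 \<partial>stdn) \<le> second_moment_bound n" (is ?second)
    "\<bar>(\<integral>a. poly S (\<omega> + \<sigma> * a) \<partial>stdn) - G \<omega> \<beta>\<bar> \<le> ln (real n) * exp (- (\<gamma>0\<^sup>2 * ln (real n)))" (is ?first)
proof -
  define s where "s = sqrt (2 * \<nu>p / \<nu>f)"
  define l where "l = ln (real n)"
  define W where "W = (\<gamma> + s)\<^sup>2 * (2 * l)"
  define L where "L = K_trunc \<gamma> \<nu>p \<nu>f n - 1"
  have \<gamma>0: "0 < \<gamma>" using pos by simp
  note thr = threshold_bounds[OF pos(1,2) \<gamma>0 \<gamma>, folded s_def]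
  have l: "0 \<le> l" using n by (simp add: l_def)
  have e: "5 / 2 \<le> exp (1::real)" "exp (1::real) \<le> 3" using exp_1_ge exp_le by auto
  have W0: "0 \<le> W" using l by (simp add: W_def)
  have "W \<le> 1 / (2 * exp 1) * (2 * l)"
    unfolding W_def using thr(3) l by (intro mult_right_mono) auto
  then have W: "W \<le> l / exp 1" by simp
  \<comment> \<open>Subtracting 1 from K leaves exactly the ceiling.\<close>
  have L_eq: "L = nat \<lceil>(exp 1)\<^sup>2 * W\<rceil>"
    by (simp add: L_def K_trunc_def W_def s_def l_def mult.assoc)
  have L: "(exp 1)\<^sup>2 * W \<le> real L" "real L \<le> (exp 1)\<^sup>2 * W + 1"
    using W0 unfolding L_eq by (auto simp: of_nat_nat)
  have eW: "(exp 1)\<^sup>2 * W \<le> exp 1 * l"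
    using mult_left_mono[OF W, of "(exp 1)\<^sup>2"] by (simp add: power2_eq_square)
  have \<omega>2: "\<omega>\<^sup>2 \<le> W"
  proof -
    have "\<bar>\<omega>\<bar>\<^sup>2 \<le> ((\<gamma> + s) * sqrt (2 * l))\<^sup>2"
      using \<omega> by (intro power_mono) (auto simp: s_def l_def)
    then show ?thesis using l by (simp add: W_def power_mult_distrib)
  qed
  have \<sigma>2: "\<sigma>\<^sup>2 \<le> 1 / (2 * exp 1)"
    using thr(2) power_mono[OF \<sigma>, of 2] by (simp add: s_def)
  have "real L + 2 \<le> 3 + 3 * l"
    using L(2) eW mult_right_mono[OF e(2) l] by linarith
  then have L2: "(real (L + 2))\<^sup>2 \<le> (3 + 3 * l)\<^sup>2" by (intro power_mono) auto
  have inv: "1 / exp (1::real) \<le> 2 / 5" using e(1) by (simp add: field_simps)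
  have "real (L + 1) * \<sigma>\<^sup>2 \<le> (exp 1 * l + 2) * (1 / (2 * exp 1))"
    using L(2) eW \<sigma>2 l by (intro mult_mono) auto
  also have "\<dots> = l / 2 + 1 / exp 1" by (simp add: field_simps)
  finally have "real (L + 1) * \<sigma>\<^sup>2 \<le> l / 2 + 1" using inv by linarith
  moreover have "\<omega>\<^sup>2 \<le> 2 / 5 * l"
  proof -
    have "l / exp 1 \<le> 2 / 5 * l" using mult_right_mono[OF inv l] by simp
    then show ?thesis using \<omega>2 W by linarith
  qed
  ultimately have "\<omega>\<^sup>2 + real (L + 1) * \<sigma>\<^sup>2 \<le> 1 + 9 / 10 * l" by linarith
  then have "exp (\<omega>\<^sup>2 + real (L + 1) * \<sigma>\<^sup>2) \<le> exp 1 * exp (9 / 10 * l)"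
    unfolding exp_add[symmetric] by (simp only: exp_le_cancel_iff)
  also have "\<dots> \<le> 3 * exp (9 / 10 * l)" using e(2) by (intro mult_right_mono) auto
  finally have ex: "exp (\<omega>\<^sup>2 + real (L + 1) * \<sigma>\<^sup>2) \<le> 3 * exp (9 / 10 * l)" .
  have "(\<integral>a. (poly S (\<omega> + \<sigma> * a))\<^sup>2 \<partial>stdn) \<le>
      (real (L + 2))\<^sup>2 * exp (\<omega>\<^sup>2 + real (L + 1) * \<sigma>\<^sup>2)"
    unfolding S_def L_def by (rule integral_G_series_sq_le[OF \<beta>])
  also have "\<dots> \<le> (3 + 3 * l)\<^sup>2 * (3 * exp (9 / 10 * l))"
    using L2 ex by (intro mult_mono) auto
  finally show ?second by (simp add: second_moment_bound_def l_def)
  define J where "J = (L + 1) div 2"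
  \<comment> \<open>J is L / 2 rounded up, so half of the lower bound on L carries over.\<close>
  have "L \<le> 2 * J" by (auto simp: J_def)
  then have J: "(exp 1)\<^sup>2 * W \<le> 2 * real J" using L(1) by linarith
  have "(\<omega>\<^sup>2 / 2) ^ J / fact J \<le> (real J / (exp 1)\<^sup>2) ^ J / fact J"
  proof -
    have "(exp 1)\<^sup>2 * \<omega>\<^sup>2 \<le> (exp 1)\<^sup>2 * W" by (rule mult_left_mono[OF \<omega>2]) simp
    from order.trans[OF this J] have "\<omega>\<^sup>2 * (exp 1)\<^sup>2 \<le> 2 * real J" by (simp only: mult.commute)
    then show ?thesis by (intro divide_right_mono power_mono) (auto simp: field_simps)
  qed
  also have "\<dots> = real J ^ J / fact J * exp (- (2 * real J))"
    by (simp add: power_divide exp_minus exp_of_nat_mult[symmetric] power_mult[symmetric] field_simps flip: exp_of_nat2_mult)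
  \<comment> \<open>J^J / J! is a single term of the series for exp J; the e^2 in K has contributed
    exp (- 2 J).\<close>
  also have "\<dots> \<le> exp (real J) * exp (- (2 * real J))"
    using power_le_fact_mult_exp[of "real J" J] by (intro mult_right_mono) (auto simp: field_simps)
  also have "\<dots> = exp (- real J)" by (simp add: exp_add[symmetric])
  also have "\<dots> \<le> exp (- (\<gamma>0\<^sup>2 * l))"
  proof -
    have "\<gamma>0\<^sup>2 \<le> (\<gamma> + s)\<^sup>2" using pos thr(1) by (intro power_mono) auto
    then have "2 * (\<gamma>0\<^sup>2 * l) \<le> W" using l by (auto simp: W_def intro!: mult_right_mono)
    also have "W \<le> (exp 1)\<^sup>2 * W" using W0 e(1) mult_right_mono[of 1 "(exp 1)\<^sup>2" W] by (simp add: one_le_power)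
    finally show ?thesis using J by simp
  qed
  finally have r: "(\<omega>\<^sup>2 / 2) ^ J / fact J \<le> exp (- (\<gamma>0\<^sup>2 * l))" .
  have "\<omega>\<^sup>2 \<le> l" using \<open>\<omega>\<^sup>2 \<le> 2 / 5 * l\<close> l by linarith
  have "\<bar>(\<integral>a. poly S (\<omega> + \<sigma> * a) \<partial>stdn) - G \<omega> \<beta>\<bar> = \<bar>G \<omega> \<beta> - poly (G_series \<beta> 0 L) \<omega>\<bar>"
    unfolding S_def integral_G_series L_def by (rule abs_minus_commute)
  also have "\<dots> \<le> \<omega>\<^sup>2 * ((\<omega>\<^sup>2 / 2) ^ J / fact J)"
    by (rule abs_G_minus_series_le) (simp add: J_def)
  also have "\<dots> \<le> l * exp (- (\<gamma>0\<^sup>2 * l))"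
    using r \<open>\<omega>\<^sup>2 \<le> l\<close> l by (intro mult_mono) auto
  finally show ?first by (simp add: l_def)
qed

text \<open>The four terms come from the linear branches, from the middle branch for large \<omega>,
  from truncation, and from the series remainder.\<close>

definition bias_bound :: "real \<Rightarrow> nat \<Rightarrow> real" where
  "bias_bound \<gamma>0 n = 16 / (\<gamma>0 * sqrt (2 * ln (real n))) + 5 / sqrt (2 * ln (real n)) +
    second_moment_bound n / real n + ln (real n) * exp (- (\<gamma>0\<^sup>2 * ln (real n)))"

text \<open>The second term, of order n / sqrt (log n), dominates; 16 ln n bounds twice the squared
  target in the near case.\<close>

definition variance_bound :: "nat \<Rightarrow> real" where
  "variance_bound n = 38 + 4 * real n / sqrt (2 * ln (real n)) + 2 * second_moment_bound n +
    16 * ln (real n)"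

text \<open>Transfers \<open>T_uv_bounds\<close> by undoing the rotation and averaging over the
  auxiliary variable. Through \<gamma>0, the condition on n makes the thresholds of all coordinates
  at least 1 simultaneously.\<close>

lemma T_hat_bounds:
  fixes \<theta> \<nu>p \<nu>f \<gamma> \<gamma>0 \<beta> :: real and n :: nat and \<tau> :: ennreal
  assumes pos: "0 < \<nu>p" "0 < \<nu>f" "0 < \<gamma>0" "\<gamma>0 \<le> \<gamma>"
    and \<gamma>: "\<gamma> < 1 / sqrt (4 * exp 1) - sqrt (\<nu>p / \<nu>f)"
    and \<beta>: "0 \<le> \<beta>" "\<beta> \<le> 1"
    and n: "1 \<le> \<gamma>0 * sqrt (2 * ln (real n))" "1 \<le> n"
  defines "\<omega> \<equiv> c_coef \<beta> \<nu>p \<nu>f \<tau> + d_coef \<nu>p \<nu>f \<tau> * \<theta>"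
    and "N \<equiv> density lborel (normal_density \<theta> (sqrt \<nu>p))"
    and "T \<equiv> \<lambda>x. T_hat \<beta> \<nu>p \<nu>f \<gamma> n x \<tau>"
  shows "integrable N T" "integrable N (\<lambda>x. (T x - G \<omega> \<beta>)\<^sup>2)"
    "\<bar>(\<integral>x. T x \<partial>N) - G \<omega> \<beta>\<bar> \<le> bias_bound \<gamma>0 n"
    "(\<integral>x. (T x - G \<omega> \<beta>)\<^sup>2 \<partial>N) \<le> variance_bound n"
proof -
  define s where "s = sqrt (2 * \<nu>p / \<nu>f)"
  define t where "t = sqrt (2 * ln (real n))"
  define \<sigma> where "\<sigma> = d_coef \<nu>p \<nu>f \<tau> * sqrt (2 * \<nu>p)"
  define S where "S = G_series \<beta> (\<sigma>\<^sup>2) (K_trunc \<gamma> \<nu>p \<nu>f n - 1)"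
  define g where "g = G \<omega> \<beta>"
  have \<gamma>pos: "0 < \<gamma>" using pos by simp
  note thr = threshold_bounds[OF pos(1,2) \<gamma>pos \<gamma>, folded s_def]
  have \<sigma>: "\<bar>\<sigma>\<bar> \<le> s" unfolding \<sigma>_def s_def by (rule abs_d_coef_mult_le[OF pos(1,2)])
  have s1: "s \<le> 1" "0 \<le> \<gamma>" "\<gamma> \<le> 1" using thr \<gamma>pos by auto
  have l0: "0 \<le> ln (real n)" using n(2) by simp
  have t0: "0 \<le> t" by (simp add: t_def l0)
  have "\<gamma>0 * t \<le> 1 * t" using pos s1 t0 by (intro mult_right_mono) auto
  then have t1: "1 \<le> t" using n(1)[folded t_def] by linarith
  have \<gamma>t: "1 \<le> \<gamma> * t" using n(1)[folded t_def] mult_right_mono[OF pos(4) t0] by linarith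
  have n_exp: "real n = exp (t\<^sup>2 / 2)" using n(2) l0 by (simp add: t_def)
  have nonneg: "0 \<le> second_moment_bound n" "0 \<le> ln (real n) * exp (- (\<gamma>0\<^sup>2 * ln (real n)))"
    using l0 by (simp_all add: second_moment_bound_def)
  note near = G_series_near_bounds[OF pos \<gamma> \<beta> \<sigma>[unfolded s_def] n(2), of \<omega>,
      folded s_def t_def S_def]
  define F where "F = (\<lambda>(a, b). T_uv \<beta> (\<gamma> * t) S (real n) (\<omega> + \<sigma> * a) (\<omega> + \<sigma> * b))"
  note bounds = T_uv_bounds[OF \<beta> thr(1) \<sigma> s1 t1 \<gamma>t n_exp near nonneg, folded g_def]
  have F2: "(\<lambda>(a, b). (T_uv \<beta> (\<gamma> * t) S (real n) (\<omega> + \<sigma> * a) (\<omega> + \<sigma> * b) - g)\<^sup>2) = (\<lambda>x. (F x - g)\<^sup>2)"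
    by (auto simp: F_def fun_eq_iff)
  define H where "H = (\<lambda>(x::real, z::real). F ((x + z) / sqrt 2, (x - z) / sqrt 2))"
  have H2: "(\<lambda>(x, z). (F ((x + z) / sqrt 2, (x - z) / sqrt 2) - g)\<^sup>2) = (\<lambda>x. (H x - g)\<^sup>2)"
    by (auto simp: H_def fun_eq_iff)
  note rotF = stdn2_rotate[OF bounds(1)[folded F_def], folded H_def]
  note rotF2 = stdn2_rotate[OF bounds(2)[unfolded F2], unfolded H2]
  define h where "h = (\<lambda>w. \<integral>z. H (w, z) \<partial>stdn)"
  have h: "h w = (\<integral>z. H (w, z) \<partial>stdn)" for w by (simp add: h_def)
  note cond = stdn2_conditional_expectation[OF rotF(1) rotF2(1) h]
  have T: "T (\<theta> + sqrt \<nu>p * w) = h w" for w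
    unfolding T_def T_hat_def h_def H_def F_def
    by (intro Bochner_Integration.integral_cong refl)
       (simp add: T_rand_eq_T_uv[OF pos(1)] \<omega>_def \<sigma>_def S_def lam_def t_def)
  \<comment> \<open>Measurability of \<open>T\<close> is read off from \<open>h\<close>, which is
    \<open>T\<close> in standardized coordinates.\<close>
  have T': "T = (\<lambda>x. h ((x - \<theta>) / sqrt \<nu>p))"
  proof
    fix x
    show "T x = h ((x - \<theta>) / sqrt \<nu>p)" using T[of "(x - \<theta>) / sqrt \<nu>p"] pos(1) by simp
  qed
  have [measurable]: "h \<in> borel_measurable borel" using cond(1) by auto
  have [measurable]: "T \<in> borel_measurable borel" unfolding T' by measurable
  have N: "N = distr stdn borel (\<lambda>w. \<theta> + sqrt \<nu>p * w)"
    unfolding N_def by (rule normal_variance_eq_distr_stdn[OF pos(1)])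
  show "integrable N T"
    unfolding N using cond(1) by (subst integrable_distr_eq) (auto simp: T)
  show "integrable N (\<lambda>x. (T x - G \<omega> \<beta>)\<^sup>2)"
    unfolding N g_def[symmetric] using cond(3) by (subst integrable_distr_eq) (auto simp: T)
  have 1: "(\<integral>x. T x \<partial>N) = (\<integral>x. F x \<partial>(stdn \<Otimes>\<^sub>M stdn))"
    unfolding N by (subst integral_distr) (auto simp: T cond(2) rotF(2))
  have 2: "(\<integral>x. (T x - g)\<^sup>2 \<partial>N) \<le> (\<integral>x. (F x - g)\<^sup>2 \<partial>(stdn \<Otimes>\<^sub>M stdn))"
  proof -
    have "(\<integral>x. (T x - g)\<^sup>2 \<partial>N) = (\<integral>w. (h w - g)\<^sup>2 \<partial>stdn)"
      unfolding N by (subst integral_distr) (auto simp: T)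
    also have "\<dots> \<le> (\<integral>x. (H x - g)\<^sup>2 \<partial>(stdn \<Otimes>\<^sub>M stdn))" by (rule cond(4))
    finally show ?thesis using rotF2(2) by simp
  qed
  have "16 / (\<gamma> * t) \<le> 16 / (\<gamma>0 * t)"
    using pos t1 by (intro divide_left_mono mult_right_mono mult_pos_pos) auto
  then show "\<bar>(\<integral>x. T x \<partial>N) - G \<omega> \<beta>\<bar> \<le> bias_bound \<gamma>0 n"
    unfolding 1 bias_bound_def g_def[symmetric] t_def[symmetric]
    using bounds(3)[folded F_def] by linarith
  have "(1 + (\<gamma> + s) * t)\<^sup>2 \<le> (2 * t)\<^sup>2"
  proof (rule power_mono)
    show "1 + (\<gamma> + s) * t \<le> 2 * t" using mult_right_mono[OF thr(4) t0] t1 by linarith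
    show "0 \<le> 1 + (\<gamma> + s) * t" using thr(1) \<gamma>pos t0 by simp
  qed
  then have "2 * (1 + (\<gamma> + s) * t)\<^sup>2 \<le> 16 * ln (real n)"
    using l0 by (simp add: t_def power_mult_distrib)
  then show "(\<integral>x. (T x - G \<omega> \<beta>)\<^sup>2 \<partial>N) \<le> variance_bound n"
    unfolding variance_bound_def g_def[symmetric] t_def[symmetric]
    using 2 bounds(4)[unfolded F2] by linarith
qed

section \<open>Averaging over the coordinates\<close>

text \<open>By independence the off-diagonal terms are products of means, at most A^2, and the
  diagonal ones are at most B. Enlarging the diagonal by A^2 completes the square.\<close>

lemma PiM_sum_second_moment_le:
  fixes N :: "nat \<Rightarrow> real measure" and W :: "nat \<Rightarrow> real \<Rightarrow> real"
  assumes N: "\<And>i. prob_space (N i)" and I: "finite I"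
    and W: "\<And>i. i \<in> I \<Longrightarrow> integrable (N i) (W i)" "\<And>i. i \<in> I \<Longrightarrow> integrable (N i) (\<lambda>x. (W i x)\<^sup>2)"
    and A: "\<And>i. i \<in> I \<Longrightarrow> \<bar>\<integral>x. W i x \<partial>N i\<bar> \<le> A"
    and B: "\<And>i. i \<in> I \<Longrightarrow> (\<integral>x. (W i x)\<^sup>2 \<partial>N i) \<le> B"
  shows "(\<integral>\<^sup>+x. ennreal ((\<Sum>i\<in>I. W i (x i))\<^sup>2) \<partial>PiM I N) \<le>
    ennreal ((real (card I) * A)\<^sup>2 + real (card I) * B)"
proof -
  interpret N: prob_space "N i" for i by (rule N)
  interpret product_sigma_finite N ..
  \<comment> \<open>Writes \<open>W i (x i) * W j (x j)\<close> as a product over all coordinates,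
    with factor 1 elsewhere; the two separate conditionals also cover i = j.\<close>
  define f where "f i j k y = (if k = i then W i y else 1) * (if k = j then W j y else 1)" for i j k y
  have prod: "(\<Prod>k\<in>I. f i j k (x k)) = W i (x i) * W j (x j)" if "i \<in> I" "j \<in> I" for i j x
    using that I by (simp add: f_def prod.distrib)
  have int_f: "integrable (N k) (f i j k)" if "i \<in> I" "j \<in> I" for i j k
    unfolding f_def using W that
    by (cases "k = i"; cases "k = j") (auto simp: power2_eq_square)
  have int: "integrable (PiM I N) (\<lambda>x. W i (x i) * W j (x j))" if "i \<in> I" "j \<in> I" for i j
    using product_integrable_prod[OF I int_f[OF that]] prod[OF that] by simp
  have val: "(\<integral>x. W i (x i) * W j (x j) \<partial>PiM I N) \<le> (if i = j then B else 0) + A\<^sup>2"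
    if ij: "i \<in> I" "j \<in> I" for i j
  proof -
    have eq: "(\<integral>x. W i (x i) * W j (x j) \<partial>PiM I N) = (\<Prod>k\<in>I. \<integral>y. f i j k y \<partial>N k)"
      using product_integral_prod[OF I int_f[OF ij]] prod[OF ij] by simp
    show ?thesis
    proof (cases "i = j")
      case True
      have "(\<integral>y. f i j k y \<partial>N k) = (if k = i then \<integral>y. (W i y)\<^sup>2 \<partial>N i else 1)" for k
        using True N.prob_space by (auto simp: f_def power2_eq_square)
      then have "(\<integral>x. W i (x i) * W j (x j) \<partial>PiM I N) = (\<integral>y. (W i y)\<^sup>2 \<partial>N i)"
        unfolding eq using ij I by simp
      also have "\<dots> \<le> B + A\<^sup>2" using B[OF ij(1)] by (simp add: add_increasing2)
      finally show ?thesis using True by simp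
    next
      case False
      have "(\<integral>y. f i j k y \<partial>N k) = (if k = i then \<integral>y. W i y \<partial>N i else 1) *
          (if k = j then \<integral>y. W j y \<partial>N j else 1)" for k
        using False N.prob_space by (auto simp: f_def)
      then have "(\<integral>x. W i (x i) * W j (x j) \<partial>PiM I N) = (\<integral>y. W i y \<partial>N i) * (\<integral>y. W j y \<partial>N j)"
        unfolding eq using ij I by (simp add: prod.distrib)
      also have "\<dots> \<le> \<bar>\<integral>y. W i y \<partial>N i\<bar> * \<bar>\<integral>y. W j y \<partial>N j\<bar>"
        by (metis abs_ge_self abs_mult)
      also have "\<dots> \<le> A * A"
        using A[OF ij(1)] A[OF ij(2)] by (intro mult_mono) auto
      finally show ?thesis using False by (simp add: power2_eq_square)
    qed
  qed
  have sq: "(\<Sum>i\<in>I. W i (x i))\<^sup>2 = (\<Sum>i\<in>I. \<Sum>j\<in>I. W i (x i) * W j (x j))" for x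
    by (simp add: power2_eq_square sum_product)
  have "(\<integral>\<^sup>+x. ennreal ((\<Sum>i\<in>I. W i (x i))\<^sup>2) \<partial>PiM I N) =
      ennreal (\<integral>x. (\<Sum>i\<in>I. W i (x i))\<^sup>2 \<partial>PiM I N)"
    unfolding sq using int
    by (intro nn_integral_eq_integral Bochner_Integration.integrable_sum)
       (auto simp: sq[symmetric])
  also have "(\<integral>x. (\<Sum>i\<in>I. W i (x i))\<^sup>2 \<partial>PiM I N) =
      (\<Sum>i\<in>I. \<Sum>j\<in>I. \<integral>x. W i (x i) * W j (x j) \<partial>PiM I N)"
    unfolding sq using int
    by (simp add: Bochner_Integration.integral_sum Bochner_Integration.integrable_sum)
  also have "\<dots> \<le> (\<Sum>i\<in>I. \<Sum>j\<in>I. (if i = j then B else 0) + A\<^sup>2)"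
    by (intro sum_mono val)
  also have "\<dots> = (real (card I) * A)\<^sup>2 + real (card I) * B"
    using I by (simp add: sum.distrib power2_eq_square algebra_simps)
  finally show ?thesis by (simp add: ennreal_leI)
qed

text \<open>As the bias enters squared, each of its terms has to beat only (log log n)^4. The
  slowest terms decay like 1 / sqrt (log n).\<close>

lemma bounds_vanish:
  fixes \<gamma>0 :: real
  assumes "0 < \<gamma>0"
  shows "(\<lambda>n. ln (ln (real n)) ^ 8 * (w\<^sup>2 * ((bias_bound \<gamma>0 n)\<^sup>2 + variance_bound n / real n)))
    \<longlonglongrightarrow> 0"
proof -
  have g: "0 < \<gamma>0\<^sup>2" using assms by simp
  have "(\<lambda>n. ln (ln (real n)) ^ 4 * (16 / (\<gamma>0 * sqrt (2 * ln (real n))))) \<longlonglongrightarrow> 0"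
    "(\<lambda>n. ln (ln (real n)) ^ 4 * (5 / sqrt (2 * ln (real n)))) \<longlonglongrightarrow> 0"
    "(\<lambda>n. ln (ln (real n)) ^ 4 * (second_moment_bound n / real n)) \<longlonglongrightarrow> 0"
    "(\<lambda>n. ln (ln (real n)) ^ 4 * (ln (real n) * exp (- (\<gamma>0\<^sup>2 * ln (real n))))) \<longlonglongrightarrow> 0"
    using assms g unfolding second_moment_bound_def by real_asymp+
  then have "(\<lambda>n. ln (ln (real n)) ^ 4 * bias_bound \<gamma>0 n) \<longlonglongrightarrow> 0 + 0 + 0 + 0"
    unfolding bias_bound_def distrib_left by (intro tendsto_add)
  from tendsto_power[OF this, of 2]
  have 1: "(\<lambda>n. ln (ln (real n)) ^ 8 * (bias_bound \<gamma>0 n)\<^sup>2) \<longlonglongrightarrow> 0"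
    by (simp add: power_mult_distrib power_mult[symmetric])
  have 2: "(\<lambda>n. ln (ln (real n)) ^ 8 * (variance_bound n / real n)) \<longlonglongrightarrow> 0"
    unfolding variance_bound_def second_moment_bound_def by real_asymp
  show ?thesis
    using tendsto_mult_left[OF tendsto_add[OF 1 2], of "w\<^sup>2"] by (simp add: algebra_simps)
qed

lemma integral_obs_law_component:
  fixes f :: "real \<Rightarrow> real"
  assumes "\<And>i. i \<in> {1..n} \<Longrightarrow> 0 < \<nu>p i" "i \<in> {1..n}"
    and f: "integrable (density lborel (normal_density (\<theta> i) (sqrt (\<nu>p i)))) f"
  shows "integrable (obs_law \<theta> \<nu>p n) (\<lambda>x. f (x i))"
    "(\<integral>x. f (x i) \<partial>obs_law \<theta> \<nu>p n) = (\<integral>x. f x \<partial>density lborel (normal_density (\<theta> i) (sqrt (\<nu>p i))))"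
proof -
  let ?N = "\<lambda>i. density lborel (normal_density (\<theta> i) (sqrt (\<nu>p i)))"
  have D: "distr (PiM {1..n} ?N) (?N i) (\<lambda>x. x i) = ?N i"
    using assms(1,2) by (intro distr_PiM_component prob_space_normal_density) auto
  have X: "(\<lambda>x. x i) \<in> PiM {1..n} ?N \<rightarrow>\<^sub>M ?N i"
    using assms(2) by (rule measurable_component_singleton)
  have m: "f \<in> borel_measurable (?N i)" using f by auto
  show "integrable (obs_law \<theta> \<nu>p n) (\<lambda>x. f (x i))"
    unfolding obs_law_def using integrable_distr_eq[OF X m] f by (simp only: D)
  show "(\<integral>x. f (x i) \<partial>obs_law \<theta> \<nu>p n) = (\<integral>x. f x \<partial>?N i)"
    unfolding obs_law_def using integral_distr[OF X m] by (simp only: D)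
qed

text \<open>The expectation is a nonnegative integral and the supremum is taken in
  \<open>ennreal\<close>, so both are defined without integrability conditions.\<close>

theorem theorem1p1:
  fixes \<theta> \<nu>p \<nu>f b h \<gamma> :: "nat \<Rightarrow> real"
  assumes pos: "\<And>i. i \<ge> 1 \<Longrightarrow> \<nu>p i > 0 \<and> \<nu>f i > 0 \<and> b i > 0 \<and> h i > 0"
    and A1: "0 < (INF i\<in>{1..}. ereal (crit_ratio (b i) (h i)))"
      "(SUP i\<in>{1..}. ereal (crit_ratio (b i) (h i))) < 1"
      "(SUP i\<in>{1..}. ereal (b i + h i)) < \<infinity>"
    and A3: "(SUP i\<in>{1..}. ereal (\<nu>p i / \<nu>f i)) < ereal (1 / (4 * exp 1))"
      "(SUP i\<in>{1..}. ereal (\<nu>f i)) < \<infinity>"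
      "0 < (INF i\<in>{1..}. ereal (\<nu>p i))"
    and gamma: "\<And>i. i \<ge> 1 \<Longrightarrow> 0 < \<gamma> i \<and> \<gamma> i < 1 / sqrt (4 * exp 1) - sqrt (\<nu>p i / \<nu>f i)"
      "0 < (INF i\<in>{1..}. ereal (\<gamma> i))"
    and A2: "limsup (\<lambda>n. ereal ((\<Sum>i=1..n. \<bar>\<theta> i\<bar>) / real n)) < \<infinity>"
  shows "(\<lambda>n. ennreal ((ln (ln (real n))) ^ 8) *
           (SUP \<tau> :: ennreal. \<integral>\<^sup>+ x. ennreal ((ARE_hat b h \<nu>p \<nu>f \<gamma> n \<tau> x
                - risk b h \<nu>p \<nu>f n \<theta> (predictor b h \<nu>p \<nu>f \<tau>))\<^sup>2) \<partial>obs_law \<theta> \<nu>p n))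
         \<longlonglongrightarrow> 0"
proof -
  obtain \<gamma>0 where \<gamma>0: "0 < \<gamma>0" "\<And>i. 1 \<le> i \<Longrightarrow> \<gamma>0 \<le> \<gamma> i"
  proof -
    obtain r where r: "0 < ereal r" "ereal r < (INF i\<in>{1..}. ereal (\<gamma> i))"
      using ereal_dense2[OF gamma(2)] by auto
    have "r \<le> \<gamma> i" if "1 \<le> i" for i
      using order.strict_trans2[OF r(2) INF_lower[of i "{1..}" "\<lambda>i. ereal (\<gamma> i)"]] that by simp
    with r(1) that show ?thesis by simp
  qed
  have bounded: "\<exists>B. \<forall>i\<ge>1. f i \<le> B" if fin: "(SUP i\<in>{1..}. ereal (f i)) < \<infinity>" for f :: "nat \<Rightarrow> real"
  proof -
    obtain B where B: "(SUP i\<in>{1..}. ereal (f i)) < ereal B" using ereal_dense2[OF fin] by auto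
    have "f i \<le> B" if "1 \<le> i" for i
      using order.strict_trans1[OF SUP_upper[of i "{1..}" "\<lambda>i. ereal (f i)"] B] that by simp
    then show ?thesis by blast
  qed
  obtain B where B: "\<And>i. 1 \<le> i \<Longrightarrow> b i + h i \<le> B" using bounded[OF A1(3)] by blast
  obtain V where V: "\<And>i. 1 \<le> i \<Longrightarrow> \<nu>f i \<le> V" using bounded[OF A3(2)] by blast
  define w where "w = B * sqrt (2 * V)"
  have \<beta>: "0 \<le> crit_ratio (b i) (h i)" "crit_ratio (b i) (h i) \<le> 1" if "1 \<le> i" for i
    using pos[OF that] by (auto simp: crit_ratio_def)
  define u where "u i \<tau> = (b i + h i) * sqrt (\<nu>f i + \<nu>p i * (alpha (\<nu>p i) \<tau>)\<^sup>2)" for i \<tau>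
  have u: "0 \<le> u i \<tau>" "u i \<tau> \<le> w" if i: "1 \<le> i" for i \<tau>
  proof -
    have a: "0 \<le> alpha (\<nu>p i) \<tau>" "alpha (\<nu>p i) \<tau> \<le> 1" using alpha_bounds pos[OF i] by auto
    show "0 \<le> u i \<tau>" using pos[OF i] by (simp add: u_def)
    \<comment> \<open>That the range allowed for \<gamma> is nonempty already forces \<nu>p \<le>
      \<nu>f.\<close>
    have "sqrt (\<nu>p i / \<nu>f i) < 1 / sqrt (4 * exp 1)" using gamma(1)[OF i] by linarith
    also have "\<dots> \<le> 1" using exp_1_ge by (simp add: real_le_rsqrt)
    finally have "\<nu>p i \<le> \<nu>f i" using pos[OF i] by (simp add: divide_le_eq_1)
    moreover have "\<nu>p i * (alpha (\<nu>p i) \<tau>)\<^sup>2 \<le> \<nu>p i * 1"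
      using a pos[OF i] by (intro mult_left_mono power_le_one) auto
    ultimately have "\<nu>f i + \<nu>p i * (alpha (\<nu>p i) \<tau>)\<^sup>2 \<le> 2 * V" using V[OF i] by linarith
    then show "u i \<tau> \<le> w"
      unfolding u_def w_def using B[OF i] pos[OF i] by (intro mult_mono) auto
  qed
  define g where "g i \<tau> = G (c_coef (crit_ratio (b i) (h i)) (\<nu>p i) (\<nu>f i) \<tau> +
      d_coef (\<nu>p i) (\<nu>f i) \<tau> * \<theta> i) (crit_ratio (b i) (h i))" for i \<tau>
  define bnd where "bnd n = w\<^sup>2 * ((bias_bound \<gamma>0 n)\<^sup>2 + variance_bound n / real n)" for n
  let ?err = "\<lambda>n \<tau>. \<integral>\<^sup>+ x. ennreal ((ARE_hat b h \<nu>p \<nu>f \<gamma> n \<tau> x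
                - risk b h \<nu>p \<nu>f n \<theta> (predictor b h \<nu>p \<nu>f \<tau>))\<^sup>2) \<partial>obs_law \<theta> \<nu>p n"
  have err: "?err n \<tau> \<le> ennreal (bnd n)"
    if n: "1 \<le> \<gamma>0 * sqrt (2 * ln (real n))" "1 \<le> n" for n \<tau>
  proof -
    \<comment> \<open>The product measure lemmas want a probability space at every index; the
      standard normal law fills index 0, where no positivity is known.\<close>
    define N where "N i = (if 1 \<le> i then density lborel (normal_density (\<theta> i) (sqrt (\<nu>p i))) else stdn)" for i
    have Ni: "N i = density lborel (normal_density (\<theta> i) (sqrt (\<nu>p i)))" if "1 \<le> i" for i
      using that by (simp add: N_def)
    have prob_N: "prob_space (N i)" for i
      using pos[of i] prob_space_stdn by (auto simp: N_def intro!: prob_space_normal_density)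
    have obs: "obs_law \<theta> \<nu>p n = PiM {1..n} N"
      unfolding obs_law_def by (intro PiM_cong) (auto simp: Ni)
    define T where "T i x = T_hat (crit_ratio (b i) (h i)) (\<nu>p i) (\<nu>f i) (\<gamma> i) n x \<tau>" for i x
    define W where "W i x = u i \<tau> * (T i x - g i \<tau>)" for i x
    have T: "integrable (N i) (T i)" "integrable (N i) (\<lambda>x. (T i x - g i \<tau>)\<^sup>2)"
      "\<bar>(\<integral>x. T i x \<partial>N i) - g i \<tau>\<bar> \<le> bias_bound \<gamma>0 n"
      "(\<integral>x. (T i x - g i \<tau>)\<^sup>2 \<partial>N i) \<le> variance_bound n" if i: "1 \<le> i" for i
    proof -
      have "0 < \<nu>p i" "0 < \<nu>f i" using pos[OF i] by auto
      note T_hat_bounds[OF this \<gamma>0(1) \<gamma>0(2)[OF i] conjunct2[OF gamma(1)[OF i]] \<beta>[OF i] n,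
        where \<tau>=\<tau> and \<theta>="\<theta> i", folded g_def T_def Ni[OF i]]
      then show "integrable (N i) (T i)" "integrable (N i) (\<lambda>x. (T i x - g i \<tau>)\<^sup>2)"
      "\<bar>(\<integral>x. T i x \<partial>N i) - g i \<tau>\<bar> \<le> bias_bound \<gamma>0 n"
      "(\<integral>x. (T i x - g i \<tau>)\<^sup>2 \<partial>N i) \<le> variance_bound n" by blast+
    qed
    have risk: "risk b h \<nu>p \<nu>f n \<theta> (predictor b h \<nu>p \<nu>f \<tau>) = (\<Sum>i=1..n. u i \<tau> * g i \<tau>) / real n"
    proof -
      let ?l = "\<lambda>i x. loss_coord (b i) (h i) (\<nu>f i) (\<theta> i) (alpha (\<nu>p i) \<tau> * x +
          sqrt (\<nu>f i + alpha (\<nu>p i) \<tau> * \<nu>p i) * Phi_inv (crit_ratio (b i) (h i)))"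
      have "integrable (obs_law \<theta> \<nu>p n) (\<lambda>x. ?l i (x i)) \<and>
          (\<integral>x. ?l i (x i) \<partial>obs_law \<theta> \<nu>p n) = u i \<tau> * g i \<tau>" if i: "i \<in> {1..n}" for i
      proof -
        have p: "0 < \<nu>p i" "0 < \<nu>f i" using pos[of i] i by auto
        note c = coordinate_risk[OF p, where \<theta>="\<theta> i" and b="b i" and h="h i" and \<tau>=\<tau>]
        have pp: "0 < \<nu>p j" if "j \<in> {1..n}" for j using pos[of j] that by auto
        from integral_obs_law_component[of n \<nu>p i \<theta>, OF pp i c(1)] c(2)
        show ?thesis by (simp add: u_def g_def)
      qed
      then show ?thesis
        unfolding risk_def loss_def predictor_def
        by (simp add: Bochner_Integration.integral_sum)
    qed
    have diff: "ARE_hat b h \<nu>p \<nu>f \<gamma> n \<tau> x - risk b h \<nu>p \<nu>f n \<theta> (predictor b h \<nu>p \<nu>f \<tau>) =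
        (\<Sum>i=1..n. W i (x i) / real n)" for x
      unfolding risk ARE_hat_def W_def T_def u_def
      by (simp add: sum_subtractf right_diff_distrib diff_divide_distrib sum_divide_distrib)
    \<comment> \<open>The factor 1 / n sits in the summands, so that summing n of them squares the
      bias in full but divides the mean square error by n.\<close>
    have WN: "integrable (N i) (\<lambda>x. W i x / real n)" "integrable (N i) (\<lambda>x. (W i x / real n)\<^sup>2)"
      "\<bar>\<integral>x. W i x / real n \<partial>N i\<bar> \<le> w * bias_bound \<gamma>0 n / real n"
      "(\<integral>x. (W i x / real n)\<^sup>2 \<partial>N i) \<le> w\<^sup>2 * variance_bound n / (real n)\<^sup>2" if "i \<in> {1..n}" for i
    proof -
      have i: "1 \<le> i" using that by simp
      interpret Ni: prob_space "N i" by (rule prob_N)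
      show "integrable (N i) (\<lambda>x. W i x / real n)"
        unfolding W_def using T(1)[OF i] by simp
      have sq: "(W i x / real n)\<^sup>2 = ((u i \<tau>)\<^sup>2 / (real n)\<^sup>2) * (T i x - g i \<tau>)\<^sup>2" for x
        by (simp add: W_def power_mult_distrib power_divide)
      show "integrable (N i) (\<lambda>x. (W i x / real n)\<^sup>2)"
        unfolding sq using T(2)[OF i] by (rule integrable_mult_right)
      have "(\<integral>x. W i x / real n \<partial>N i) = u i \<tau> * ((\<integral>x. T i x \<partial>N i) - g i \<tau>) / real n"
        unfolding W_def using T(1)[OF i] Ni.prob_space
        by (simp add: Bochner_Integration.integral_diff)
      also have "\<bar>\<dots>\<bar> = u i \<tau> * \<bar>(\<integral>x. T i x \<partial>N i) - g i \<tau>\<bar> / real n"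
        using u(1)[OF i] by (simp add: abs_mult)
      also have "\<dots> \<le> w * bias_bound \<gamma>0 n / real n"
        using u[OF i, of \<tau>] T(3)[OF i] by (intro divide_right_mono mult_mono) auto
      finally show "\<bar>\<integral>x. W i x / real n \<partial>N i\<bar> \<le> w * bias_bound \<gamma>0 n / real n" .
      have "(\<integral>x. (W i x / real n)\<^sup>2 \<partial>N i) = (u i \<tau>)\<^sup>2 / (real n)\<^sup>2 * (\<integral>x. (T i x - g i \<tau>)\<^sup>2 \<partial>N i)"
        unfolding sq by simp
      also have "\<dots> \<le> w\<^sup>2 / (real n)\<^sup>2 * variance_bound n"
        using u[OF i, of \<tau>] T(4)[OF i]
        by (intro mult_mono divide_right_mono power_mono) auto
      finally show "(\<integral>x. (W i x / real n)\<^sup>2 \<partial>N i) \<le> w\<^sup>2 * variance_bound n / (real n)\<^sup>2" by simp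
    qed
    have "?err n \<tau> \<le> ennreal ((real (card {1..n}) * (w * bias_bound \<gamma>0 n / real n))\<^sup>2 +
        real (card {1..n}) * (w\<^sup>2 * variance_bound n / (real n)\<^sup>2))"
      unfolding diff obs by (intro PiM_sum_second_moment_le prob_N WN) auto
    also have "(real (card {1..n}) * (w * bias_bound \<gamma>0 n / real n))\<^sup>2 +
        real (card {1..n}) * (w\<^sup>2 * variance_bound n / (real n)\<^sup>2) = bnd n"
      using n(2) by (simp add: bnd_def power_mult_distrib power2_eq_square field_simps)
    finally show ?thesis .
  qed
  have "filterlim (\<lambda>n. \<gamma>0 * sqrt (2 * ln (real n))) at_top sequentially"
    using \<gamma>0(1) by real_asymp
  then have "\<forall>\<^sub>F n in sequentially. 1 \<le> \<gamma>0 * sqrt (2 * ln (real n))"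
    by (simp add: filterlim_at_top)
  then have ev: "\<forall>\<^sub>F n in sequentially. ennreal ((ln (ln (real n))) ^ 8) * (SUP \<tau>. ?err n \<tau>) \<le>
      ennreal (ln (ln (real n)) ^ 8 * bnd n)"
    using eventually_ge_at_top[of 1]
  proof eventually_elim
    case (elim n)
    \<comment> \<open>The bound is free of \<tau>, so it passes to the supremum at once.\<close>
    have "(SUP \<tau>. ?err n \<tau>) \<le> ennreal (bnd n)" using err[OF elim] by (intro SUP_least) auto
    then have "ennreal ((ln (ln (real n))) ^ 8) * (SUP \<tau>. ?err n \<tau>) \<le>
        ennreal ((ln (ln (real n))) ^ 8) * ennreal (bnd n)"
      by (intro mult_left_mono) auto
    also have "\<dots> = ennreal (ln (ln (real n)) ^ 8 * bnd n)"
      by (intro ennreal_mult'[symmetric]) simp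
    finally show ?case .
  qed
  have "(\<lambda>n. ennreal (ln (ln (real n)) ^ 8 * bnd n)) \<longlonglongrightarrow> ennreal 0"
    unfolding bnd_def by (intro tendsto_ennrealI bounds_vanish \<gamma>0)
  then have lim: "(\<lambda>n. ennreal (ln (ln (real n)) ^ 8 * bnd n)) \<longlonglongrightarrow> 0" by simp
  show ?thesis
    by (rule tendsto_sandwich[OF _ ev tendsto_const lim]) simp
qed

end
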